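(* Let $Q$ be a valued quiver associated to a symmetrizable generalized Cartan matrix $C=(c_{ij})_{i,j\in\mathbb I}$, $\mathbb I=\{1,\dots,N\}$. Then there exists a $\mathbb Q(v)$-algebra homomorphism $$\varphi:\mathbf U^\imath\longrightarrow\mathcal T(Q),\qquad B_i\longmapsto x_i+x_i^{-1}\quad\text{for all } i\in\mathbb I.$$
   Context: Let $\mathbb I=\{1,\dots,N\}$, let $C=(c_{ij})_{i,j\in\mathbb I}$ be a symmetrizable generalized Cartan matrix with symmetrizer $D=\mathrm{diag}(d_i\mid i\in\mathbb I)$ ($d_i$ positive integers, $DC$ symmetric). Let $v$ be an indeterminate and $v_i=v^{d_i}$. Write $[n]=\frac{v^n-v^{-n}}{v-v^{-1}}$, $[m]^!=\prod_{s=1}^m[s]$, $[0]^!=1$; a subscript $c$ means evaluation at $v=c$. **The $\imath$quantum group.** The Drinfeld–Jimbo quantum group $\mathbf U$ is the $\mathbb Q(v)$-algebra generated by $E_i,F_i,K_i,K_i^{-1}$ ($i\in\mathbb I$) subject to $K_iK_i^{-1}=K_i^{-1}K_i=1$, $K_iK_j=K_jK_i$, $E_iF_j-F_jE_i=\delta_{ij}\frac{K_i-K_i^{-1}}{v_i-v_i^{-1}}$, $K_iE_j=v_i^{c_{ij}}E_jK_i$, $K_iF_j=v_i^{-c_{ij}}F_jK_i$, and for $i\neq j$ the quantum Serre relations $\sum_{n=0}^{1-c_{ij}}(-1)^nE_i^{(n)}E_jE_i^{(1-c_{ij}-n)}=0$, $\sum_{n=0}^{1-c_{ij}}(-1)^nF_i^{(n)}F_jF_i^{(1-c_{ij}-n)}=0$,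 where $E_i^{(n)}=E_i^n/[n]^!_{v_i}$, $F_i^{(n)}=F_i^n/[n]^!_{v_i}$. With the distinguished parameters $\varsigma_i^\diamond=-v_i^{-1}(v_i-v_i^{-1})^2$, the $\imath$quantum group $\mathbf U^\imath=\mathbf U^\imath_{\boldsymbol\varsigma^\diamond}$ is the $\mathbb Q(v)$-subalgebra of $\mathbf U$ generated by $B_i=F_i+\varsigma_i^\diamond E_iK_i^{-1}$, $i\in\mathbb I$. **Valued quiver.** For $i\neq j$ let $d_{i,j}$ be the least common multiple of $d_i,d_j$. The valued graph $\Gamma(C)$ has vertex set $\mathbb I$ and, for $i\ne j$, $n_{ij}=-\frac{d_ic_{ij}}{d_{i,j}}$ parallel edges between $i$ and $j$; vertex $i$ has value $d_i$ and each edge between $i$ and $j$ has value $d_{i,j}$. A valued quiver $Q$ associated to $C$ is obtained by choosing an arbitrary orientation of each edge of $\Gamma(C)$ (parallel edges may be oriented in opposite directions). Its Euler form is the bilinear form $\langle-,-\rangle_Q$ on $\mathbb Z\mathbb I=\bigoplus_i\mathbb Ze_i$ with $\langle e_i,e_i\rangle_Q=d_i$ and $\langle e_i,e_j\rangle_Q=-r_{ij}d_{i,j}$ for $i\ne j$, where $r_{ij}$ is the number of arrows from $i$ to $j$ in $Q$. **Quantum torus.** $\mathcal T(Q)$ (the quantum torus of the word $(1,2,\dots,N)$) is the $\mathbb Q(v)$-algebra generated by $x_1^{\pm1},\dots,x_N^{\pm1}$ subject to $x_kx_k^{-1}=x_k^{-1}x_k=1$ and $x_lx_k=v^{\langle e_k,e_l\rangle_Q-\langle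 e_l,e_k\rangle_Q}x_kx_l$ for $1\le k,l\le N$. *)

theory Defs
  imports
    "HOL-Library.Poly_Mapping"
    "HOL-Computational_Algebra.Polynomial"
    "HOL-Computational_Algebra.Fraction_Field"
    "Graph_Theory.Digraph"
    "HOL-Algebra.QuotRing"
    "HOL-Algebra.Subrings"
    "HOL-Algebra.Module"
begin

section \<open>Associative algebras presented by generators and relations\<close>

text \<open>
  An algebra over a field \<open>'k\<close> is a record \<open>('k, 'a) module\<close> carrying a ring structure together
  with a scalar multiplication.  (The locale \<open>algebra\<close> of HOL-Algebra is restricted to
  commutative algebras.)
\<close>

definition subalgebra_of :: "('k, 'a) module \<Rightarrow> 'a set \<Rightarrow> bool" where
  "subalgebra_of A H \<longleftrightarrow> subring H A \<and> (\<forall>c. \<forall>x\<in>H. c \<odot>\<^bsub>A\<^esub> x \<in> H)"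

definition generated_subalgebra :: "('k, 'a) module \<Rightarrow> 'a set \<Rightarrow> ('k, 'a) module" where
  "generated_subalgebra A S = A\<lparr>carrier := \<Inter>{H. subalgebra_of A H \<and> S \<subseteq> H}\<rparr>"

definition algebra_hom :: "('k, 'a) module \<Rightarrow> ('k, 'b) module \<Rightarrow> ('a \<Rightarrow> 'b) set" where
  "algebra_hom A B =
     {h \<in> ring_hom A B. \<forall>c. \<forall>x\<in>carrier A. h (c \<odot>\<^bsub>A\<^esub> x) = c \<odot>\<^bsub>B\<^esub> h x}"

text \<open>
  Words form the free monoid, written additively so that finitely supported functions on words,
  with the convolution product of \<^theory>\<open>HOL-Library.Poly_Mapping\<close>, are noncommutative polynomials.
\<close>

datatype 'g free_word = Word (letters: "'g list")

instantiation free_word :: (type) monoid_add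
begin

definition zero_free_word :: "'g free_word" where
  "zero_free_word = Word []"

definition plus_free_word :: "'g free_word \<Rightarrow> 'g free_word \<Rightarrow> 'g free_word" where
  "plus_free_word u w = Word (letters u @ letters w)"

instance
  by standard (simp_all add: zero_free_word_def plus_free_word_def)

end

type_synonym ('g, 'k) ncpoly = "'g free_word \<Rightarrow>\<^sub>0 'k"

definition ngen :: "'g \<Rightarrow> ('g, 'k::ring_1) ncpoly" where
  "ngen g = Poly_Mapping.single (Word [g]) 1"

definition nconst :: "'k::ring_1 \<Rightarrow> ('g, 'k) ncpoly" where
  "nconst c = Poly_Mapping.single 0 c"

definition free_algebra :: "'g set \<Rightarrow> ('k::field, ('g, 'k) ncpoly) module" where
  "free_algebra G =
     \<lparr>carrier = {p. \<forall>w\<in>Poly_Mapping.keys p. set (letters w) \<subseteq> G},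
      mult = (*), one = 1, zero = 0, add = (+), smult = (\<lambda>c p. nconst c * p)\<rparr>"

lemma ring_free_algebra: "ring (free_algebra G :: ('k::field, ('g, 'k) ncpoly) module)"
proof -
  let ?C = "{p :: ('g, 'k) ncpoly. \<forall>w\<in>Poly_Mapping.keys p. set (letters w) \<subseteq> G}"
  have add: "p + q \<in> ?C" if "p \<in> ?C" "q \<in> ?C" for p q
    using that Poly_Mapping.keys_add[of p q] by blast
  have mult: "p * q \<in> ?C" if "p \<in> ?C" "q \<in> ?C" for p q
    using that Poly_Mapping.keys_mult[of p q] by (fastforce simp: plus_free_word_def)
  have neg: "- p \<in> ?C" if "p \<in> ?C" for p
    using that by simp
  have one: "1 \<in> ?C"
    by (simp add: zero_free_word_def)
  have inv: "\<exists>q\<in>?C. q + p = 0" if "p \<in> ?C" for p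
    by (rule bexI[OF _ neg[OF that]]) simp
  have zero: "0 \<in> ?C"
    by simp
  note sel = free_algebra_def ring.simps monoid.simps partial_object.simps
  show ?thesis
  proof (rule ringI)
    show "abelian_group (free_algebra G :: ('k, ('g, 'k) ncpoly) module)"
      by (rule abelian_groupI; unfold sel)
        (assumption | rule add zero inv add.assoc add.commute add_0_left)+
    show "Group.monoid (free_algebra G :: ('k, ('g, 'k) ncpoly) module)"
      by (rule monoidI; unfold sel)
        (assumption | rule mult one mult.assoc mult_1_left mult_1_right)+
  qed (unfold sel, rule distrib_right, rule distrib_left)
qed


text \<open>
  The algebra generated by \<open>G\<close> subject to the relations \<open>r = 0\<close> for \<open>r \<in> R\<close>, that is, the free
  algebra modulo the two-sided ideal generated by \<open>R\<close>.
\<close>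

definition presented_algebra ::
    "'g set \<Rightarrow> ('g, 'k::field) ncpoly set \<Rightarrow> ('k, ('g, 'k) ncpoly set) module" where
  "presented_algebra G R =
    (let A = free_algebra G; I = Idl\<^bsub>A\<^esub> R in
      ring.extend (A Quot I)
        (module.fields (\<lambda>c X. \<Union>x\<in>X. I +>\<^bsub>A\<^esub> (c \<odot>\<^bsub>A\<^esub> x))))"

definition presented_gen :: "'g set \<Rightarrow> ('g, 'k::field) ncpoly set \<Rightarrow> 'g \<Rightarrow> ('g, 'k) ncpoly set" where
  "presented_gen G R g = (let A = free_algebra G in (Idl\<^bsub>A\<^esub> R) +>\<^bsub>A\<^esub> ngen g)"


section \<open>Cartan data and valued quivers\<close>

text \<open>The index set is \<open>{1..N}\<close>; values of \<open>C\<close> and \<open>d\<close> outside of it are irrelevant.\<close>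

definition generalized_cartan_matrix :: "nat \<Rightarrow> (nat \<Rightarrow> nat \<Rightarrow> int) \<Rightarrow> bool" where
  "generalized_cartan_matrix N C \<longleftrightarrow>
     (\<forall>i\<in>{1..N}. C i i = 2) \<and>
     (\<forall>i\<in>{1..N}. \<forall>j\<in>{1..N}. i \<noteq> j \<longrightarrow> C i j \<le> 0) \<and>
     (\<forall>i\<in>{1..N}. \<forall>j\<in>{1..N}. C i j = 0 \<longleftrightarrow> C j i = 0)"

definition is_symmetrizer :: "nat \<Rightarrow> (nat \<Rightarrow> nat \<Rightarrow> int) \<Rightarrow> (nat \<Rightarrow> nat) \<Rightarrow> bool" where
  "is_symmetrizer N C d \<longleftrightarrow>
     (\<forall>i\<in>{1..N}. d i > 0) \<and>
     (\<forall>i\<in>{1..N}. \<forall>j\<in>{1..N}. int (d i) * C i j = int (d j) * C j i)"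

record 'e valued_quiver =
  quiver :: "(nat, 'e) pre_digraph"
  vertex_value :: "nat \<Rightarrow> nat"
  arrow_value :: "'e \<Rightarrow> nat"

text \<open>
  The number \<open>n\<^sub>i\<^sub>j\<close> of edges between \<open>i\<close> and \<open>j\<close> in the valued graph of \<open>C\<close>.  The division is exact,
  since \<open>d\<^sub>i c\<^sub>i\<^sub>j = d\<^sub>j c\<^sub>j\<^sub>i\<close> is a multiple of both \<open>d\<^sub>i\<close> and \<open>d\<^sub>j\<close>.
\<close>

definition edge_number :: "(nat \<Rightarrow> nat \<Rightarrow> int) \<Rightarrow> (nat \<Rightarrow> nat) \<Rightarrow> nat \<Rightarrow> nat \<Rightarrow> int" where
  "edge_number C d i j = (- (int (d i) * C i j)) div int (lcm (d i) (d j))"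

text \<open>
  A valued quiver is associated to \<open>C\<close> if forgetting the orientation of its arrows gives the
  valued graph of \<open>C\<close>.
\<close>

definition valued_quiver_of ::
    "nat \<Rightarrow> (nat \<Rightarrow> nat \<Rightarrow> int) \<Rightarrow> (nat \<Rightarrow> nat) \<Rightarrow> 'e valued_quiver \<Rightarrow> bool" where
  "valued_quiver_of N C d Q \<longleftrightarrow>
     (let D = quiver Q in
       fin_digraph D \<and> loopfree_digraph D \<and> verts D = {1..N} \<and>
       (\<forall>i\<in>{1..N}. \<forall>j\<in>{1..N}. i \<noteq> j \<longrightarrow>
          int (card {a \<in> arcs D. {tail D a, head D a} = {i, j}}) = edge_number C d i j) \<and>
       (\<forall>i\<in>{1..N}. vertex_value Q i = d i) \<and>
       (\<forall>a\<in>arcs D. arrow_value Q a = lcm (d (tail D a)) (d (head D a))))"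

definition arrow_number :: "'e valued_quiver \<Rightarrow> nat \<Rightarrow> nat \<Rightarrow> nat" where
  "arrow_number Q i j =
     card {a \<in> arcs (quiver Q). tail (quiver Q) a = i \<and> head (quiver Q) a = j}"

definition euler_entry :: "'e valued_quiver \<Rightarrow> nat \<Rightarrow> nat \<Rightarrow> int" where
  "euler_entry Q i j =
     (if i = j then int (vertex_value Q i)
      else - int (arrow_number Q i j) * int (lcm (vertex_value Q i) (vertex_value Q j)))"

definition euler_form :: "'e valued_quiver \<Rightarrow> (nat \<Rightarrow> int) \<Rightarrow> (nat \<Rightarrow> int) \<Rightarrow> int" where
  "euler_form Q a b =
     (\<Sum>i\<in>verts (quiver Q). \<Sum>j\<in>verts (quiver Q). a i * b j * euler_entry Q i j)"

definition unit_vec :: "nat \<Rightarrow> nat \<Rightarrow> int" where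
  "unit_vec i = (\<lambda>k. if k = i then 1 else 0)"


section \<open>The quantum group and the iquantum group\<close>

text \<open>The field \<open>\<rat>(v)\<close>.\<close>

type_synonym ratfun = "rat poly fract"

definition qv :: ratfun where
  "qv = Fract [:0, 1:] 1"

text \<open>Quantum integers and factorials evaluated at \<open>v = c\<close>.\<close>

definition qint :: "ratfun \<Rightarrow> nat \<Rightarrow> ratfun" where
  "qint c n = (c ^ n - inverse c ^ n) / (c - inverse c)"

definition qfact :: "ratfun \<Rightarrow> nat \<Rightarrow> ratfun" where
  "qfact c m = (\<Prod>s=1..m. qint c s)"

definition divided_power :: "ratfun \<Rightarrow> ('g, ratfun) ncpoly \<Rightarrow> nat \<Rightarrow> ('g, ratfun) ncpoly" where
  "divided_power c x n = nconst (inverse (qfact c n)) * x ^ n"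

datatype dj_gen = Egen nat | Fgen nat | Kgen nat | Kinv nat

definition dj_gens :: "nat \<Rightarrow> dj_gen set" where
  "dj_gens N = Egen ` {1..N} \<union> Fgen ` {1..N} \<union> Kgen ` {1..N} \<union> Kinv ` {1..N}"

definition serre_element ::
    "(nat \<Rightarrow> nat \<Rightarrow> int) \<Rightarrow> (nat \<Rightarrow> nat) \<Rightarrow> (nat \<Rightarrow> ('g, ratfun) ncpoly) \<Rightarrow> nat \<Rightarrow> nat
      \<Rightarrow> ('g, ratfun) ncpoly" where
  "serre_element C d X i j =
     (let m = nat (1 - C i j); c = qv ^ d i in
       \<Sum>n=0..m. (- 1) ^ n * divided_power c (X i) n * X j * divided_power c (X i) (m - n))"

definition dj_rels ::
    "nat \<Rightarrow> (nat \<Rightarrow> nat \<Rightarrow> int) \<Rightarrow> (nat \<Rightarrow> nat) \<Rightarrow> (dj_gen, ratfun) ncpoly set" where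
  "dj_rels N C d =
    (let E = (\<lambda>i. ngen (Egen i)); F = (\<lambda>i. ngen (Fgen i));
         K = (\<lambda>i. ngen (Kgen i)); K' = (\<lambda>i. ngen (Kinv i)); v = (\<lambda>i. qv ^ d i);
         I = {1..N}
     in {K i * K' i - 1 | i. i \<in> I}
      \<union> {K' i * K i - 1 | i. i \<in> I}
      \<union> {K i * K j - K j * K i | i j. i \<in> I \<and> j \<in> I}
      \<union> {E i * F j - F j * E i
            - (if i = j then nconst (1 / (v i - inverse (v i))) * (K i - K' i) else 0)
          | i j. i \<in> I \<and> j \<in> I}
      \<union> {K i * E j - nconst (v i powi C i j) * E j * K i | i j. i \<in> I \<and> j \<in> I}
      \<union> {K i * F j - nconst (v i powi (- C i j)) * F j * K i | i j. i \<in> I \<and> j \<in> I}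
      \<union> {serre_element C d E i j | i j. i \<in> I \<and> j \<in> I \<and> i \<noteq> j}
      \<union> {serre_element C d F i j | i j. i \<in> I \<and> j \<in> I \<and> i \<noteq> j})"

definition quantum_group ::
    "nat \<Rightarrow> (nat \<Rightarrow> nat \<Rightarrow> int) \<Rightarrow> (nat \<Rightarrow> nat) \<Rightarrow> (ratfun, (dj_gen, ratfun) ncpoly set) module" where
  "quantum_group N C d = presented_algebra (dj_gens N) (dj_rels N C d)"

definition dj_elem ::
    "nat \<Rightarrow> (nat \<Rightarrow> nat \<Rightarrow> int) \<Rightarrow> (nat \<Rightarrow> nat) \<Rightarrow> dj_gen \<Rightarrow> (dj_gen, ratfun) ncpoly set" where
  "dj_elem N C d = presented_gen (dj_gens N) (dj_rels N C d)"

definition varsigma :: "(nat \<Rightarrow> nat) \<Rightarrow> nat \<Rightarrow> ratfun" where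
  "varsigma d i = (let c = qv ^ d i in - inverse c * (c - inverse c)\<^sup>2)"

definition iB ::
    "nat \<Rightarrow> (nat \<Rightarrow> nat \<Rightarrow> int) \<Rightarrow> (nat \<Rightarrow> nat) \<Rightarrow> nat \<Rightarrow> (dj_gen, ratfun) ncpoly set" where
  "iB N C d i =
    (let U = quantum_group N C d in
      dj_elem N C d (Fgen i) \<oplus>\<^bsub>U\<^esub>
        varsigma d i \<odot>\<^bsub>U\<^esub> (dj_elem N C d (Egen i) \<otimes>\<^bsub>U\<^esub> dj_elem N C d (Kinv i)))"

definition iquantum_group ::
    "nat \<Rightarrow> (nat \<Rightarrow> nat \<Rightarrow> int) \<Rightarrow> (nat \<Rightarrow> nat) \<Rightarrow> (ratfun, (dj_gen, ratfun) ncpoly set) module" where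
  "iquantum_group N C d = generated_subalgebra (quantum_group N C d) (iB N C d ` {1..N})"


section \<open>The quantum torus\<close>

datatype torus_gen = Xgen nat | Xinv nat

definition torus_gens :: "nat \<Rightarrow> torus_gen set" where
  "torus_gens N = Xgen ` {1..N} \<union> Xinv ` {1..N}"

definition torus_rels :: "nat \<Rightarrow> 'e valued_quiver \<Rightarrow> (torus_gen, ratfun) ncpoly set" where
  "torus_rels N Q =
    (let x = (\<lambda>k. ngen (Xgen k)); x' = (\<lambda>k. ngen (Xinv k)); I = {1..N};
         e = (\<lambda>k l. euler_form Q (unit_vec k) (unit_vec l))
     in {x k * x' k - 1 | k. k \<in> I}
      \<union> {x' k * x k - 1 | k. k \<in> I}
      \<union> {x l * x k - nconst (qv powi (e k l - e l k)) * x k * x l | k l. k \<in> I \<and> l \<in> I})"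

definition quantum_torus ::
    "nat \<Rightarrow> 'e valued_quiver \<Rightarrow> (ratfun, (torus_gen, ratfun) ncpoly set) module" where
  "quantum_torus N Q = presented_algebra (torus_gens N) (torus_rels N Q)"

definition torus_elem ::
    "nat \<Rightarrow> 'e valued_quiver \<Rightarrow> torus_gen \<Rightarrow> (torus_gen, ratfun) ncpoly set" where
  "torus_elem N Q = presented_gen (torus_gens N) (torus_rels N Q)"

end

theory Submission
  imports Defs
begin

text \<open>
  The presentation of the iquantum group by iSerre relations is avoided.  Let \<open>V\<close> be the free
  algebra on the letters \<open>1, \<dots>, N\<close>, with \<open>P\<^sub>i\<close> the left multiplication by \<open>i\<close>.  The algebra \<open>\<^bold>U\<close> acts on
  \<open>V\<close> up to the Serre relations of the \<open>F\<^sub>i = P\<^sub>i\<close>: modulo them \<open>V\<close> is the Verma module of highest weight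
  \<open>0\<close>.  Put \<open>q\<^sub>i = \<sigma>\<^sub>i E\<^sub>i K\<^sub>i\<^sup>-\<^sup>1\<close> with the distinguished parameter \<open>\<sigma>\<^sub>i\<close>, so that \<open>B\<^sub>i\<close> acts as \<open>P\<^sub>i + q\<^sub>i\<close>.
  As \<open>q\<^sub>i\<close> lowers degrees, there is a unique linear map \<open>\<theta>\<close> from \<open>V\<close> to the quantum torus with \<open>\<theta>(1) = 1\<close> and
  \<open>\<theta>(B\<^sub>i u) = (x\<^sub>i + x\<^sub>i\<^sup>-\<^sup>1) \<theta>(u)\<close>.  If \<open>\<theta>\<close> kills the Serre relations, then an expression in
  the \<open>B\<^sub>i\<close> that vanishes in \<open>\<^bold>U\<close>, applied to \<open>1 \<in> V\<close> and mapped by \<open>\<theta>\<close>, shows that the same expression in the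
  \<open>x\<^sub>i + x\<^sub>i\<^sup>-\<^sup>1\<close> vanishes.

  With \<open>m = - c\<^sub>i\<^sub>j\<close> and \<open>v = v\<^sub>i\<close>, the iterated \<open>v\<close>-commutators \<open>Y\<^sub>0 = F\<^sub>j\<close>,
  \<open>Y\<^sub>n\<^sub>+\<^sub>1 = F\<^sub>i Y\<^sub>n - v\<^sup>2\<^sup>n\<^sup>-\<^sup>m Y\<^sub>n F\<^sub>i\<close> satisfy
  \<open>B\<^sub>i Y\<^sub>n = Y\<^sub>n\<^sub>+\<^sub>1 + v\<^sup>2\<^sup>n\<^sup>-\<^sup>m Y\<^sub>n B\<^sub>i + (1 - v\<^sup>2\<^sup>n) (1 - v\<^sup>2\<^sup>n\<^sup>-\<^sup>2\<^sup>m\<^sup>-\<^sup>2) Y\<^sub>n\<^sub>-\<^sub>1\<close>.  Hence the Serre element, a multiple of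
  \<open>Y\<^sub>m\<^sub>+\<^sub>1\<close>, is a continuant in the left and right multiplications by \<open>B\<^sub>i\<close>, applied to \<open>F\<^sub>j\<close>.  For \<open>q\<^sub>j\<close> in
  place of \<open>F\<^sub>j\<close> one gets the continuant with reversed coefficients, which is the same, and it vanishes by the
  Serre relation for \<open>E\<close>; so \<open>F\<^sub>j\<close> may be replaced by \<open>B\<^sub>j\<close>.  In the quantum torus the three-term recursion is that of
  the Al-Salam--Chihara polynomials, and the product formula for their generating function shows that the continuant
  of degree \<open>m + 1\<close> annihilates \<open>x\<^sub>j\<close> and \<open>x\<^sub>j\<^sup>-\<^sup>1\<close>.
\<close>

section \<open>Iterated quantum commutators and continuants\<close>

text \<open>For \<open>w = v_i\<close> and \<open>u\<close> the \<open>c_ij\<close>-th power of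
  \<open>v_i\<close>, these are the last coefficients of the three-term recursion. The truncated
  exponent at \<open>n = 0\<close> is harmless, since the first factor is then zero.\<close>

definition qad_coeff :: "'k::field \<Rightarrow> 'k \<Rightarrow> nat \<Rightarrow> 'k" where
  "qad_coeff w u n = (1 - w ^ (2 * n)) * (1 - u ^ 2 * w ^ (2 * n - 2))"

locale bilinear_algebra = vector_space scale
  for scale :: "'k::field \<Rightarrow> 'a::ring_1 \<Rightarrow> 'a" (infixr \<open>*s\<close> 75) +
  assumes scale_mult_left [simp]: "(c *s x) * y = c *s (x * y)"
    and scale_mult_right [simp]: "x * (c *s y) = c *s (x * y)"
begin

text \<open>
  The continuant of the tridiagonal matrix with diagonal entries \<open>L - b\<^sub>k R\<close> and products \<open>g\<^sub>k\<close> of opposite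
  off-diagonal entries, where \<open>L\<close> and \<open>R\<close> are the left and right multiplications by \<open>B\<close>, applied to \<open>z\<close>.
\<close>

fun continuant :: "(nat \<Rightarrow> 'k) \<Rightarrow> (nat \<Rightarrow> 'k) \<Rightarrow> 'a \<Rightarrow> 'a \<Rightarrow> nat \<Rightarrow> 'a" where
  "continuant b g B z 0 = z"
| "continuant b g B z (Suc 0) = B * z - b 0 *s (z * B)"
| "continuant b g B z (Suc (Suc n)) =
     B * continuant b g B z (Suc n) - b (Suc n) *s (continuant b g B z (Suc n) * B)
       - g (Suc n) *s continuant b g B z n"

lemma continuant_cong:
  assumes "\<And>k. k < n \<Longrightarrow> b k = b' k" "\<And>k. 0 < k \<Longrightarrow> k < n \<Longrightarrow> g k = g' k"
  shows "continuant b g B z n = continuant b' g' B z n"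
  using assms by (induction b g B z n rule: continuant.induct) auto

lemma continuant_add:
  "continuant b g B (x + y) n = continuant b g B x n + continuant b g B y n"
  by (induction b g B x n rule: continuant.induct) (auto simp: algebra_simps)

text \<open>Left and right multiplication by \<open>B\<close> commute, so the tridiagonal
  determinant has commuting entries and can be expanded at its first diagonal entry instead of its
  last.\<close>

lemma continuant_left:
  "continuant b g B z (Suc (Suc n)) =
     B * continuant (\<lambda>k. b (Suc k)) (\<lambda>k. g (Suc k)) B z (Suc n)
       - b 0 *s (continuant (\<lambda>k. b (Suc k)) (\<lambda>k. g (Suc k)) B z (Suc n) * B)
       - g 1 *s continuant (\<lambda>k. b (Suc (Suc k))) (\<lambda>k. g (Suc (Suc k))) B z n"
proof (induction n rule: less_induct)
  case (less n)
  consider "n = 0" | "n = 1" | k where "n = Suc (Suc k)"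
    by (metis One_nat_def not0_implies_Suc)
  then show ?case
  proof cases
    case 1
    then show ?thesis by (simp add: algebra_simps)
  next
    case 2
    then show ?thesis by (simp add: algebra_simps)
  next
    case (3 k)
    note IH = less[of k] less[of "Suc k"]
    have expand: "continuant b g B z (Suc (Suc n)) =
        B * continuant b g B z (Suc n) - b (Suc n) *s (continuant b g B z (Suc n) * B)
          - g (Suc n) *s continuant b g B z n" by simp
    show ?thesis
      unfolding expand
      using IH 3
      by (simp only: continuant.simps(3)[of "\<lambda>k. b (Suc k)"] continuant.simps(3)[of "\<lambda>k. b (Suc (Suc k))"])
         (simp add: algebra_simps del: continuant.simps)
  qed
qed

text \<open>Expansion at the first diagonal entry is the defining recursion of the reversed
  determinant. The entries of \<open>b\<close> run over \<open>0..n-1\<close> and those of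
  \<open>g\<close> over \<open>1..n-1\<close>, hence the two different reflections.\<close>

lemma continuant_reverse:
  "continuant b g B z n = continuant (\<lambda>k. b (n - Suc k)) (\<lambda>k. g (n - k)) B z n"
proof (induction n rule: less_induct)
  case (less n)
  consider "n = 0" | "n = 1" | k where "n = Suc (Suc k)"
    by (metis One_nat_def not0_implies_Suc)
  then show ?case
  proof cases
    case (3 k)
    show ?thesis
      unfolding 3
      using less[of "Suc k"] less[of k] 3
      by (simp add: continuant_left[of "\<lambda>i. b (Suc k - i)"] del: continuant.simps(3))
         (simp add: continuant.simps(3))
  qed simp_all
qed

primrec qad :: "'k \<Rightarrow> 'k \<Rightarrow> 'a \<Rightarrow> 'a \<Rightarrow> nat \<Rightarrow> 'a" where
  "qad w u f x 0 = x"
| "qad w u f x (Suc n) = f * qad w u f x n - (u * w ^ (2 * n)) *s (qad w u f x n * f)"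

lemma qad_commute:
  assumes "y * f = a *s (f * y)" "y * x = a' *s (x * y)"
  shows "y * qad w u f x n = (a ^ n * a') *s (qad w u f x n * y)"
proof (induction n)
  case (Suc n)
  let ?Y = "qad w u f x n"
  have "y * (f * ?Y) = (a * (a ^ n * a')) *s (f * ?Y * y)"
    by (simp add: mult.assoc[symmetric] assms) (simp add: mult.assoc Suc)
  moreover have "y * (?Y * f) = (a * (a ^ n * a')) *s (?Y * f * y)"
    by (simp add: mult.assoc[symmetric] Suc) (simp add: mult.assoc assms mult.commute)
  ultimately show ?case
    by (simp add: right_diff_distrib left_diff_distrib scale_right_diff_distrib mult.assoc mult.commute mult.left_commute)
qed (use assms in simp)

text \<open>Typically \<open>e = q_i\<close>, \<open>f = P_i\<close>, \<open>x = P_j\<close> and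
  \<open>k\<close> is the inverse square of \<open>K_i\<close>: moving \<open>e\<close> through the
  iterated commutator removes one factor \<open>f\<close>. The hypotheses also hold with the roles
  of \<open>P\<close> and \<open>q\<close> exchanged and all parameters inverted.\<close>

lemma qad_lower:
  assumes ef: "e * f = w\<^sup>2 *s (f * e) + (1 - w\<^sup>2) *s (1 - k)"
    and kf: "k * f = w ^ 4 *s (f * k)" and kx: "k * x = u\<^sup>2 *s (x * k)"
    and ex: "e * x = u *s (x * e)" and "w \<noteq> 0"
  shows "e * qad w u f x n =
     (u * w ^ (2 * n)) *s (qad w u f x n * e) + qad_coeff w u n *s qad w u f x (n - 1)"
proof (induction n)
  case 0
  then show ?case using ex by (simp add: qad_coeff_def)
next
  case (Suc n)
  let ?Y = "qad w u f x n" and ?Y' = "qad w u f x (n - 1)" and ?b = "u * w ^ (2 * n)" and ?g = "qad_coeff w u n"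
  have kY: "k * ?Y = ?b\<^sup>2 *s (?Y * k)"
    using qad_commute[OF kf kx, of w u n] by (simp add: power_mult_distrib power_mult[symmetric] mult.commute)
  \<comment> \<open>The recursion for \<open>?Y\<close>, with previous coefficient
    \<open>?b / w^2\<close>. The factor \<open>?g\<close> makes it valid at \<open>n = 0\<close>
    too, where \<open>?g = 0\<close>.\<close>
  have prev: "?g *s ?Y = ?g *s (f * ?Y') - (?g * (?b / w\<^sup>2)) *s (?Y' * f)"
    using \<open>w \<noteq> 0\<close> by (cases n) (simp_all add: qad_coeff_def algebra_simps power2_eq_square)
  have 1: "e * (f * ?Y) = (w\<^sup>2 * ?b) *s (f * ?Y * e) + (w\<^sup>2 * ?g) *s (f * ?Y') + (1 - w\<^sup>2) *s ?Y
      - ((1 - w\<^sup>2) * ?b\<^sup>2) *s (?Y * k)"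
    by (simp add: mult.assoc[symmetric] ef distrib_right)
       (simp add: mult.assoc Suc kY algebra_simps)
  have 2: "e * (?Y * f) = (?b * w\<^sup>2) *s (?Y * f * e) + (?b * (1 - w\<^sup>2)) *s ?Y
      - (?b * (1 - w\<^sup>2)) *s (?Y * k) + ?g *s (?Y' * f)"
    by (simp add: mult.assoc[symmetric] Suc distrib_right)
       (simp add: mult.assoc ef algebra_simps)
  \<comment> \<open>The induction step produces this recursion, of which \<open>qad_coeff\<close> is
    the closed form.\<close>
  have coeff: "qad_coeff w u (Suc n) = w\<^sup>2 * ?g + (1 - w\<^sup>2) - (1 - w\<^sup>2) * ?b\<^sup>2"
    using \<open>w \<noteq> 0\<close> by (cases n) (simp_all add: qad_coeff_def algebra_simps power2_eq_square)
  have "e * qad w u f x (Suc n) = (w\<^sup>2 * ?b) *s (f * ?Y * e - ?b *s (?Y * f * e))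
     + (1 - w\<^sup>2 - (1 - w\<^sup>2) * ?b\<^sup>2) *s ?Y + w\<^sup>2 *s (?g *s (f * ?Y') - (?g * (?b / w\<^sup>2)) *s (?Y' * f))"
    using \<open>w \<noteq> 0\<close>
    by (simp add: right_diff_distrib 1 2) (simp add: algebra_simps power2_eq_square)
  then show ?case
    unfolding prev[symmetric] coeff by (simp add: algebra_simps power2_eq_square)
qed

text \<open>Typically \<open>y = q_j\<close> and \<open>x = P_j\<close>: now \<open>y\<close> acts
  on the innermost factor. The terms free of \<open>k\<close> cancel in the first commutator, and
  each further one multiplies the remainder by \<open>u\<close> times a new factor of the product.
  Once a factor is zero, \<open>y\<close> commutes with the commutator up to a scalar.\<close>

lemma qad_lower':
  assumes yf: "y * f = u *s (f * y)" and yx: "y * x = a *s (x * y) + t *s (1 - k)"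
    and kf: "k * f = u\<^sup>2 *s (f * k)"
  shows "y * qad w u f x (Suc n) = (u ^ Suc n * a) *s (qad w u f x (Suc n) * y)
     - (t * u ^ Suc n * (\<Prod>i\<le>n. 1 - u\<^sup>2 * w ^ (2 * i))) *s (f ^ Suc n * k)"
proof (induction n)
  case 0
  have 1: "y * (f * x) = (u * a) *s (f * x * y) + (u * t) *s f - (u * t) *s (f * k)"
    by (simp add: mult.assoc[symmetric] yf) (simp add: mult.assoc yx algebra_simps)
  have 2: "y * (x * f) = (u * a) *s (x * f * y) + t *s f - (u\<^sup>2 * t) *s (f * k)"
    by (simp add: mult.assoc[symmetric] yx distrib_right)
       (simp add: mult.assoc yf kf algebra_simps)
  show ?case
    by (simp add: right_diff_distrib 1 2) (simp add: algebra_simps power2_eq_square)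
next
  case (Suc n)
  let ?Y = "qad w u f x (Suc n)" and ?b = "u * w ^ (2 * Suc n)"
  define \<nu> where "\<nu> = t * u ^ Suc n * (\<Prod>i\<le>n. 1 - u\<^sup>2 * w ^ (2 * i))"
  define c where "c = u ^ Suc n * a"
  have IH: "y * ?Y = c *s (?Y * y) - \<nu> *s (f ^ Suc n * k)"
    unfolding \<nu>_def c_def by (rule Suc)
  have 1: "y * (f * ?Y) = (u * c) *s (f * ?Y * y) - (u * \<nu>) *s (f ^ Suc (Suc n) * k)"
    by (simp only: mult.assoc[symmetric] yf)
       (simp add: mult.assoc IH right_diff_distrib scale_right_diff_distrib del: qad.simps)
  have fc: "f ^ n * (f * z) = f * (f ^ n * z)" for z
    by (simp add: mult.assoc[symmetric] power_commutes)
  have 2: "y * (?Y * f) = (u * c) *s (?Y * f * y) - (u\<^sup>2 * \<nu>) *s (f ^ Suc (Suc n) * k)"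
    by (simp only: mult.assoc[symmetric] IH left_diff_distrib scale_mult_left)
       (simp add: mult.assoc yf kf fc mult.commute del: qad.simps)
  have Y: "qad w u f x (Suc (Suc n)) = f * ?Y - ?b *s (?Y * f)" by simp
  have cf: "u ^ Suc (Suc n) * a = u * c" by (simp add: c_def)
  have \<nu>f: "t * u ^ Suc (Suc n) * (\<Prod>i\<le>Suc n. 1 - u\<^sup>2 * w ^ (2 * i)) = \<nu> * (u - ?b * u\<^sup>2)"
    by (simp add: \<nu>_def algebra_simps power2_eq_square)
  show ?case
    unfolding Y cf \<nu>f
    by (simp add: right_diff_distrib left_diff_distrib 1 2 del: qad.simps)
       (simp add: algebra_simps del: qad.simps)
qed

text \<open>By \<open>qad_lower\<close>, everything that \<open>e\<close> contributes to the
  three-term recursion is cancelled by its last term; what remains is the recursion of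
  \<open>qad\<close> in \<open>f\<close>.\<close>

lemma continuant_eq_qad:
  assumes ef: "e * f = w\<^sup>2 *s (f * e) + (1 - w\<^sup>2) *s (1 - k)"
    and kf: "k * f = w ^ 4 *s (f * k)" and kx: "k * x = u\<^sup>2 *s (x * k)"
    and ex: "e * x = u *s (x * e)" and "w \<noteq> 0"
  shows "continuant (\<lambda>n. u * w ^ (2 * n)) (qad_coeff w u) (f + e) x n = qad w u f x n"
proof (induction n rule: less_induct)
  case (less n)
  note lower = qad_lower[OF assms]
  consider "n = 0" | "n = 1" | k where "n = Suc (Suc k)"
    by (metis One_nat_def not0_implies_Suc)
  then show ?case
  proof cases
    case 2
    then show ?thesis using lower[of 0]
      by (simp add: algebra_simps qad_coeff_def)
  next
    case (3 k)
    show ?thesis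
      unfolding 3 continuant.simps(3)
      using less[of "Suc k"] less[of k] 3 lower[of "Suc k"]
      by (simp del: qad.simps continuant.simps)
         (simp add: qad.simps(2)[of _ _ _ _ "Suc k"] algebra_simps del: qad.simps continuant.simps)
  qed simp
qed

end

section \<open>Congruences modulo a two-sided ideal\<close>

locale algebra_ideal = bilinear_algebra +
  fixes I :: "'b set"
  assumes zero_mem: "0 \<in> I"
    and add_mem: "p \<in> I \<Longrightarrow> q \<in> I \<Longrightarrow> p + q \<in> I"
    and mult_left_mem: "p \<in> I \<Longrightarrow> a * p \<in> I"
    and mult_right_mem: "p \<in> I \<Longrightarrow> p * a \<in> I"
begin

lemma scale_mem: "p \<in> I \<Longrightarrow> c *s p \<in> I"
  using mult_left_mem[of p "c *s 1"] by simp

lemma minus_mem: "p \<in> I \<Longrightarrow> - p \<in> I"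
  using mult_left_mem[of p "- 1"] by simp

lemma diff_mem: "p \<in> I \<Longrightarrow> q \<in> I \<Longrightarrow> p - q \<in> I"
  using add_mem[OF _ minus_mem] by fastforce

lemma sum_mem: "(\<And>i. i \<in> A \<Longrightarrow> p i \<in> I) \<Longrightarrow> sum p A \<in> I"
  by (induction A rule: infinite_finite_induct) (auto intro: zero_mem add_mem)

definition eqv :: "'b \<Rightarrow> 'b \<Rightarrow> bool" (infix \<open>\<approx>\<close> 50) where
  "p \<approx> q \<longleftrightarrow> p - q \<in> I"

lemma eqv_refl [simp]: "p \<approx> p"
  by (simp add: eqv_def zero_mem)

lemma eqv_sym: "p \<approx> q \<Longrightarrow> q \<approx> p"
  unfolding eqv_def using minus_mem by fastforce

lemma eqv_trans [trans]: "p \<approx> q \<Longrightarrow> q \<approx> r \<Longrightarrow> p \<approx> r"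
  unfolding eqv_def using add_mem by fastforce

lemma eqv_add: "p \<approx> p' \<Longrightarrow> q \<approx> q' \<Longrightarrow> p + q \<approx> p' + q'"
  unfolding eqv_def by (drule (1) add_mem) (simp add: algebra_simps)

lemma eqv_diff: "p \<approx> p' \<Longrightarrow> q \<approx> q' \<Longrightarrow> p - q \<approx> p' - q'"
  unfolding eqv_def by (drule (1) diff_mem) (simp add: algebra_simps)

lemma eqv_scale: "p \<approx> p' \<Longrightarrow> c *s p \<approx> c *s p'"
  unfolding eqv_def by (drule scale_mem[of _ c]) (simp add: algebra_simps)

lemma eqv_mult_left: "p \<approx> p' \<Longrightarrow> a * p \<approx> a * p'"
  unfolding eqv_def by (drule mult_left_mem[of _ a]) (simp add: algebra_simps)

lemma eqv_mult_right: "p \<approx> p' \<Longrightarrow> p * a \<approx> p' * a"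
  unfolding eqv_def by (drule mult_right_mem[of _ a]) (simp add: algebra_simps)

lemma eqv_sum: "(\<And>i. i \<in> A \<Longrightarrow> p i \<approx> q i) \<Longrightarrow> sum p A \<approx> sum q A"
  unfolding eqv_def by (simp add: sum_subtractf[symmetric] sum_mem)

end

section \<open>Continuants in a quantum torus and the quantum Serre relations\<close>

context algebra_ideal
begin

text \<open>Modulo \<open>I\<close>, the continuant of degree \<open>n\<close> is \<open>P n\<close>
  times the sum over \<open>a + b = n\<close> of
  \<open>\<alpha> s a * \<alpha> (inverse s) b\<close> times \<open>Z * X ^ a * X' ^ b\<close>. The
  first coefficient vanishes for \<open>a > r\<close> and the second for \<open>b > t\<close>, so
  nothing survives in degree \<open>r + t + 1\<close>.\<close>

lemma qtorus_continuant_mem: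
  fixes X X' Z :: 'b
  assumes inv: "X * X' \<approx> 1" "X' * X \<approx> 1"
    and XZ: "X * Z \<approx> s *s (Z * X)" "X' * Z \<approx> inverse s *s (Z * X')"
    and w: "\<And>n. n > 0 \<Longrightarrow> w ^ (2 * n) \<noteq> 1"
    and s: "s = u * w ^ (2 * r)" "inverse s = u * w ^ (2 * t)" and "s \<noteq> 0" "w \<noteq> 0"
  shows "continuant (\<lambda>n. u * w ^ (2 * n)) (qad_coeff w u) (X + X') Z (Suc (r + t)) \<in> I"
proof -
  \<comment> \<open>The monomials are not reduced by \<open>X * X' \<approx> 1\<close>; this keeps
    every sum \<open>S\<close> homogeneous in \<open>a + b\<close>.\<close>
  define mono where "mono a b = Z * X ^ a * X' ^ b" for a b
  \<comment> \<open>The coefficients of the two factors of the generating function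
    \<open>\<Prod>\<^sub>k\<^sub><\<^sub>r (1 - u w\<^sup>2\<^sup>k X z) \<Prod>\<^sub>k\<^sub><\<^sub>t (1 - u w\<^sup>2\<^sup>k X' z)\<close>.\<close>
  define \<alpha> where "\<alpha> x n = (\<Prod>k<n. (x - u * w ^ (2 * k)) / (1 - w ^ (2 * Suc k)))" for x n
  \<comment> \<open>The shift by one takes the value 0 at index 0, so that sums over
    \<open>a \<le> n\<close> become sums over \<open>a \<le> Suc n\<close> without boundary
    terms.\<close>
  define \<alpha>' where "\<alpha>' x n = (case n of 0 \<Rightarrow> 0 | Suc k \<Rightarrow> \<alpha> x k)" for x n
  define P where "P n = (\<Prod>k=1..n. 1 - w ^ (2 * k))" for n
  define S where "S f g n = (\<Sum>a\<le>n. (f a * g (n - a)) *s mono a (n - a))" for f g n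
  let ?B = "X + X'"
  have w': "1 - w ^ (2 * Suc k) \<noteq> 0" for k
    using w[of "Suc k"] by simp
  have X'X: "X' * X ^ a \<approx> X ^ a * X'" for a
  proof (induction a)
    case (Suc a)
    have "X' * X ^ Suc a = (X' * X) * X ^ a" by (simp add: mult.assoc)
    also have "\<dots> \<approx> 1 * X ^ a" by (intro eqv_mult_right inv)
    also have "\<dots> = X ^ a * 1" by simp
    also have "\<dots> \<approx> X ^ a * (X * X')" by (intro eqv_mult_left eqv_sym[OF inv(1)])
    also have "\<dots> = X ^ Suc a * X'" by (simp add: mult.assoc[symmetric] power_commutes)
    finally show ?case .
  qed simp
  have X'bX: "X' ^ b * X \<approx> X * X' ^ b" for b
  proof (induction b)
    case (Suc b)
    have "X' ^ Suc b * X = X' * (X' ^ b * X)" by (simp add: mult.assoc)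
    also have "\<dots> \<approx> X' * (X * X' ^ b)" by (intro eqv_mult_left Suc)
    also have "\<dots> = (X' * X) * X' ^ b" by (simp add: mult.assoc)
    also have "\<dots> \<approx> 1 * X' ^ b" by (intro eqv_mult_right inv)
    also have "\<dots> \<approx> (X * X') * X' ^ b" by (intro eqv_mult_right eqv_sym[OF inv(1)])
    also have "\<dots> = X * X' ^ Suc b" by (simp add: mult.assoc)
    finally show ?case .
  qed simp
  have left: "?B * mono a b \<approx> s *s mono (Suc a) b + inverse s *s mono a (Suc b)" for a b
  proof -
    have "X * mono a b = (X * Z) * (X ^ a * X' ^ b)" by (simp add: mono_def mult.assoc)
    also have "\<dots> \<approx> (s *s (Z * X)) * (X ^ a * X' ^ b)" by (intro eqv_mult_right XZ)
    also have "\<dots> = s *s mono (Suc a) b" by (simp add: mono_def mult.assoc)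
    finally have 1: "X * mono a b \<approx> s *s mono (Suc a) b" .
    have "X' * mono a b = (X' * Z) * (X ^ a * X' ^ b)" by (simp add: mono_def mult.assoc)
    also have "\<dots> \<approx> (inverse s *s (Z * X')) * (X ^ a * X' ^ b)" by (intro eqv_mult_right XZ)
    also have "\<dots> = inverse s *s (Z * ((X' * X ^ a) * X' ^ b))" by (simp add: mult.assoc)
    also have "\<dots> \<approx> inverse s *s (Z * ((X ^ a * X') * X' ^ b))"
      by (intro eqv_scale eqv_mult_left eqv_mult_right X'X)
    also have "\<dots> = inverse s *s mono a (Suc b)" by (simp add: mono_def mult.assoc)
    finally show ?thesis unfolding distrib_right using 1 by (rule eqv_add[rotated])
  qed
  have right: "mono a b * ?B \<approx> mono (Suc a) b + mono a (Suc b)" for a b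
  proof -
    have "mono a b * X = Z * X ^ a * (X' ^ b * X)" by (simp add: mono_def mult.assoc)
    also have "\<dots> \<approx> Z * X ^ a * (X * X' ^ b)" by (intro eqv_mult_left X'bX)
    also have "\<dots> = mono (Suc a) b" by (simp only: mono_def mult.assoc power_Suc2)
    finally have "mono a b * X \<approx> mono (Suc a) b" .
    moreover have "mono a b * X' = mono a (Suc b)"
      by (simp only: mono_def mult.assoc power_Suc2)
    ultimately show ?thesis by (simp add: distrib_left eqv_add)
  qed
  \<comment> \<open>Inserting \<open>X * X'\<close> lifts the last term of the recursion by two
    degrees, to the degree of the other terms.\<close>
  have shift: "mono a b \<approx> mono (Suc a) (Suc b)" for a b
  proof -
    have "mono a b = Z * X ^ a * (1 * X' ^ b)" by (simp add: mono_def)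
    also have "\<dots> \<approx> Z * X ^ a * ((X * X') * X' ^ b)"
      by (intro eqv_mult_left eqv_mult_right eqv_sym[OF inv(1)])
    also have "\<dots> = mono (Suc a) (Suc b)"
      by (simp only: mono_def mult.assoc power_Suc2[of X] power_Suc[of X'])
    finally show ?thesis .
  qed
  have S1: "(\<Sum>a\<le>n. (\<alpha> x a * g (n - a)) *s mono (Suc a) (n - a)) = S (\<alpha>' x) g (Suc n)" for x g n
    unfolding S_def by (subst sum.atMost_Suc_shift) (simp add: \<alpha>'_def)
  have S2: "(\<Sum>a\<le>n. (f a * \<alpha> x (n - a)) *s mono a (Suc (n - a))) = S f (\<alpha>' x) (Suc n)" for x f n
    unfolding S_def by (simp add: \<alpha>'_def Suc_diff_le)
  have S_left: "?B * S (\<alpha> s) (\<alpha> (inverse s)) n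
      \<approx> s *s S (\<alpha>' s) (\<alpha> (inverse s)) (Suc n) + inverse s *s S (\<alpha> s) (\<alpha>' (inverse s)) (Suc n)" for n
  proof -
    have "?B * S (\<alpha> s) (\<alpha> (inverse s)) n
        = (\<Sum>a\<le>n. (\<alpha> s a * \<alpha> (inverse s) (n - a)) *s (?B * mono a (n - a)))"
      unfolding S_def by (simp add: sum_distrib_left del: distrib_right)
    also have "\<dots> \<approx> (\<Sum>a\<le>n. (\<alpha> s a * \<alpha> (inverse s) (n - a)) *s
        (s *s mono (Suc a) (n - a) + inverse s *s mono a (Suc (n - a))))"
      by (intro eqv_sum eqv_scale left)
    also have "\<dots> = s *s S (\<alpha>' s) (\<alpha> (inverse s)) (Suc n) + inverse s *s S (\<alpha> s) (\<alpha>' (inverse s)) (Suc n)"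
      by (simp add: S1[symmetric] S2[symmetric] scale_right_distrib sum.distrib scale_sum_right mult_ac)
    finally show ?thesis .
  qed
  have S_right: "S (\<alpha> s) (\<alpha> (inverse s)) n * ?B
      \<approx> S (\<alpha>' s) (\<alpha> (inverse s)) (Suc n) + S (\<alpha> s) (\<alpha>' (inverse s)) (Suc n)" for n
  proof -
    have "S (\<alpha> s) (\<alpha> (inverse s)) n * ?B
        = (\<Sum>a\<le>n. (\<alpha> s a * \<alpha> (inverse s) (n - a)) *s (mono a (n - a) * ?B))"
      unfolding S_def by (simp add: sum_distrib_right del: distrib_left)
    also have "\<dots> \<approx> (\<Sum>a\<le>n. (\<alpha> s a * \<alpha> (inverse s) (n - a)) *s
        (mono (Suc a) (n - a) + mono a (Suc (n - a))))"
      by (intro eqv_sum eqv_scale right)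
    also have "\<dots> = S (\<alpha>' s) (\<alpha> (inverse s)) (Suc n) + S (\<alpha> s) (\<alpha>' (inverse s)) (Suc n)"
      by (simp add: S1[symmetric] S2[symmetric] scale_right_distrib sum.distrib)
    finally show ?thesis .
  qed
  have S_shift: "S (\<alpha> s) (\<alpha> (inverse s)) n \<approx> S (\<alpha>' s) (\<alpha>' (inverse s)) (Suc (Suc n))" for n
  proof -
    have "S (\<alpha> s) (\<alpha> (inverse s)) n
        \<approx> (\<Sum>a\<le>n. (\<alpha> s a * \<alpha> (inverse s) (n - a)) *s mono (Suc a) (Suc (n - a)))"
      unfolding S_def by (intro eqv_sum eqv_scale shift)
    also have "\<dots> = (\<Sum>a\<le>Suc n. (\<alpha> s a * \<alpha>' (inverse s) (Suc n - a)) *s mono (Suc a) (Suc n - a))"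
      by (simp add: \<alpha>'_def Suc_diff_le)
    also have "\<dots> = S (\<alpha>' s) (\<alpha>' (inverse s)) (Suc (Suc n))"
      by (rule S1)
    finally show ?thesis .
  qed
  \<comment> \<open>The ratio of consecutive coefficients; both sides are zero at
    \<open>a = 0\<close>.\<close>
  have \<alpha>_rec: "(1 - w ^ (2 * a)) * \<alpha> x a = (x - u * w ^ (2 * a) / w\<^sup>2) * \<alpha>' x a" for x a
    using w'[of "a - 1"] \<open>w \<noteq> 0\<close>
    by (cases a) (simp_all add: \<alpha>_def \<alpha>'_def power2_eq_square)
  \<comment> \<open>This compares the coefficients of \<open>mono a b\<close> in the three-term
    recursion.\<close>
  have coeff: "s * (\<alpha>' s a * \<alpha> (inverse s) b) + inverse s * (\<alpha> s a * \<alpha>' (inverse s) b)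
      - u * w ^ (2 * n) * (\<alpha>' s a * \<alpha> (inverse s) b + \<alpha> s a * \<alpha>' (inverse s) b)
      - (1 - u\<^sup>2 * (w ^ (2 * n) / w\<^sup>2)) * (\<alpha>' s a * \<alpha>' (inverse s) b)
      = (1 - w ^ (2 * Suc n)) * (\<alpha> s a * \<alpha> (inverse s) b)" if ab: "a + b = Suc n" for a b n
  proof -
    define p q where "p = u * w ^ (2 * a) / w\<^sup>2" and "q = u * w ^ (2 * b) / w\<^sup>2"
    define A A' B B' si where "A = \<alpha> s a" and "A' = \<alpha>' s a" and "B = \<alpha> (inverse s) b"
      and "B' = \<alpha>' (inverse s) b" and "si = inverse s"
    define qa qb where "qa = w ^ (2 * a)" and "qb = w ^ (2 * b)"
    have "w ^ (2 * Suc n) = qa * qb"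
      by (simp only: ab[symmetric] qa_def qb_def power_add[symmetric] distrib_left)
    moreover from this have w2n: "w ^ (2 * n) = qa * qb / w\<^sup>2"
      using \<open>w \<noteq> 0\<close> by (simp add: power2_eq_square field_simps)
    then have "u * w ^ (2 * n) = p * qb" "p * qb = q * qa" "u\<^sup>2 * (w ^ (2 * n) / w\<^sup>2) = p * q"
      unfolding p_def q_def qa_def[symmetric] qb_def[symmetric] by (simp_all add: power2_eq_square)
    moreover have eqs: "(1 - qa) * A = (s - p) * A'" "(1 - qb) * B = (si - q) * B'" "s * si = 1"
      using \<alpha>_rec[of a s] \<alpha>_rec[of b "inverse s"] \<open>s \<noteq> 0\<close>
      by (auto simp: p_def q_def A_def A'_def B_def B'_def qa_def qb_def si_def)
    moreover have "s * (A' * B) + si * (A * B') - p * qb * (A' * B) - q * qa * (A * B')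
        - (1 - p * q) * (A' * B') = (1 - qa * qb) * (A * B)"
    proof -
      \<comment> \<open>The difference of the two sides is an explicit combination of
        \<open>h1\<close>, \<open>h2\<close> and \<open>s * si - 1\<close>, all of which are
        zero.\<close>
      define h1 h2 where "h1 = (1 - qa) * A - (s - p) * A'" and "h2 = (1 - qb) * B - (si - q) * B'"
      have "s * (A' * B) + si * (A * B') - p * qb * (A' * B) - q * qa * (A * B')
          - (1 - p * q) * (A' * B') - (1 - qa * qb) * (A * B)
        = h1 * h2 - h1 * B - h2 * A + h1 * ((si - q) * B' + q * B') + h2 * ((s - p) * A' + p * A')
          + (s * si - 1) * (A' * B')"
        unfolding h1_def h2_def by (simp add: algebra_simps)
      moreover have "h1 = 0" "h2 = 0" "s * si = 1"
        using eqs by (simp_all add: h1_def h2_def)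
      ultimately show ?thesis by simp
    qed
    ultimately show ?thesis
      unfolding A_def[symmetric] A'_def[symmetric] B_def[symmetric] B'_def[symmetric]
      unfolding si_def[symmetric] by (simp add: distrib_left diff_diff_eq)
  qed
  have step: "?B * S (\<alpha> s) (\<alpha> (inverse s)) n - (u * w ^ (2 * n)) *s (S (\<alpha> s) (\<alpha> (inverse s)) n * ?B)
      - (1 - u\<^sup>2 * (w ^ (2 * n) / w\<^sup>2)) *s S (\<alpha>' s) (\<alpha>' (inverse s)) (Suc n)
      \<approx> (1 - w ^ (2 * Suc n)) *s S (\<alpha> s) (\<alpha> (inverse s)) (Suc n)" (is "?l \<approx> ?r") for n
  proof -
    have "?l \<approx> (s *s S (\<alpha>' s) (\<alpha> (inverse s)) (Suc n) + inverse s *s S (\<alpha> s) (\<alpha>' (inverse s)) (Suc n))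
      - (u * w ^ (2 * n)) *s (S (\<alpha>' s) (\<alpha> (inverse s)) (Suc n) + S (\<alpha> s) (\<alpha>' (inverse s)) (Suc n))
      - (1 - u\<^sup>2 * (w ^ (2 * n) / w\<^sup>2)) *s S (\<alpha>' s) (\<alpha>' (inverse s)) (Suc n)"
      by (intro eqv_diff S_left eqv_scale S_right eqv_refl)
    also have "\<dots> = (\<Sum>a\<le>Suc n. (s * (\<alpha>' s a * \<alpha> (inverse s) (Suc n - a)) + inverse s * (\<alpha> s a * \<alpha>' (inverse s) (Suc n - a))
      - u * w ^ (2 * n) * (\<alpha>' s a * \<alpha> (inverse s) (Suc n - a) + \<alpha> s a * \<alpha>' (inverse s) (Suc n - a))
      - (1 - u\<^sup>2 * (w ^ (2 * n) / w\<^sup>2)) * (\<alpha>' s a * \<alpha>' (inverse s) (Suc n - a))) *s mono a (Suc n - a))"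
      unfolding S_def
      by (simp only: scale_sum_right sum.distrib[symmetric] sum_subtractf[symmetric]
            scale_scale scale_left_distrib scale_left_diff_distrib distrib_left scale_right_distrib)
    also have "\<dots> = ?r"
      unfolding S_def scale_sum_right scale_scale by (intro sum.cong refl arg_cong2[where f = scale] coeff) auto
    finally show ?thesis .
  qed
  have P_Suc: "P (Suc n) = P n * (1 - w ^ (2 * Suc n))" for n
    by (simp add: P_def)
  have main: "continuant (\<lambda>n. u * w ^ (2 * n)) (qad_coeff w u) ?B Z n \<approx> P n *s S (\<alpha> s) (\<alpha> (inverse s)) n" for n
  proof (induction n rule: less_induct)
    case (less n)
    consider "n = 0" | "n = 1" | k where "n = Suc (Suc k)"
      by (metis One_nat_def not0_implies_Suc)
    then show ?case
    proof cases
      case 1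
      then show ?thesis by (simp add: P_def S_def \<alpha>_def mono_def)
    next
      case 2
      have "S (\<alpha> s) (\<alpha> (inverse s)) 0 = Z" "S (\<alpha>' s) (\<alpha>' (inverse s)) (Suc 0) = 0"
        by (simp_all add: S_def \<alpha>_def \<alpha>'_def mono_def)
      then show ?thesis using step[of 0] 2 by (simp add: P_def)
    next
      case (3 k)
      let ?n = "Suc k" and ?S = "S (\<alpha> s) (\<alpha> (inverse s))"
      \<comment> \<open>The factor \<open>1 - w ^ (2 * ?n)\<close> of \<open>qad_coeff\<close> turns
        \<open>P k\<close> into \<open>P ?n\<close>, so a common factor \<open>P ?n\<close> can be
        taken out.\<close>
      have g: "qad_coeff w u ?n * P k = P ?n * (1 - u\<^sup>2 * (w ^ (2 * ?n) / w\<^sup>2))"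
        using \<open>w \<noteq> 0\<close> by (simp add: P_Suc qad_coeff_def power2_eq_square)
      have "continuant (\<lambda>n. u * w ^ (2 * n)) (qad_coeff w u) ?B Z n
         \<approx> ?B * (P ?n *s ?S ?n) - (u * w ^ (2 * ?n)) *s ((P ?n *s ?S ?n) * ?B) - qad_coeff w u ?n *s (P k *s ?S k)"
        unfolding 3 continuant.simps(3) using 3
        by (intro eqv_diff eqv_scale eqv_mult_left eqv_mult_right less) auto
      also have "\<dots> = P ?n *s (?B * ?S ?n - (u * w ^ (2 * ?n)) *s (?S ?n * ?B) - (1 - u\<^sup>2 * (w ^ (2 * ?n) / w\<^sup>2)) *s ?S k)"
        by (simp only: scale_mult_left scale_mult_right scale_scale g scale_right_diff_distrib mult.commute[of "P ?n" "u * w ^ (2 * ?n)"])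
      also have "\<dots> \<approx> P ?n *s (?B * ?S ?n - (u * w ^ (2 * ?n)) *s (?S ?n * ?B)
          - (1 - u\<^sup>2 * (w ^ (2 * ?n) / w\<^sup>2)) *s S (\<alpha>' s) (\<alpha>' (inverse s)) (Suc ?n))"
        by (intro eqv_scale eqv_diff eqv_refl S_shift)
      also have "\<dots> \<approx> P ?n *s ((1 - w ^ (2 * Suc ?n)) *s ?S (Suc ?n))"
        by (intro eqv_scale step)
      finally show ?thesis using 3 by (simp add: P_Suc)
    qed
  qed
  have \<alpha>_zero: "\<alpha> x n = 0" if "x = u * w ^ (2 * k)" "k < n" for x k n
    unfolding \<alpha>_def using that by (intro prod_zero) auto
  have "S (\<alpha> s) (\<alpha> (inverse s)) (Suc (r + t)) = 0"
    unfolding S_def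
  proof (intro sum.neutral ballI)
    fix a
    have "r < a \<or> t < Suc (r + t) - a" by linarith
    then show "(\<alpha> s a * \<alpha> (inverse s) (Suc (r + t) - a)) *s mono a (Suc (r + t) - a) = 0"
      using \<alpha>_zero[OF s(1)] \<alpha>_zero[OF s(2)] by auto
  qed
  then show ?thesis
    using main[of "Suc (r + t)"] by (simp add: eqv_def)
qed

end

section \<open>Quantum binomial coefficients and the Serre element\<close>

lemma qint_inverse: "qint (inverse c) n = qint c n"
proof (cases "c - inverse c = 0")
  case False
  then have "inverse c - c \<noteq> 0" by auto
  then show ?thesis using False by (simp add: qint_def divide_simps) (simp add: algebra_simps)
qed (simp add: qint_def)

text \<open>Through this symmetry one Serre element matches both the iterated commutators for
  \<open>v_i\<close> and those for its inverse, which occur for the operators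
  \<open>qop\<close>.\<close>

lemma qfact_inverse: "qfact (inverse c) n = qfact c n"
  by (simp add: qfact_def qint_inverse)

lemma qint_nonzero:
  assumes "c \<noteq> 0" "\<And>n. n > 0 \<Longrightarrow> c ^ (2 * n) \<noteq> 1" "n > 0"
  shows "qint c n \<noteq> 0"
proof -
  have "c ^ k - inverse c ^ k \<noteq> 0" if "k > 0" for k
    using assms(1) assms(2)[of k] that by (auto simp: field_simps power_mult[symmetric] mult_2 power_add mult_2_right)
  from this[of n] this[of 1] show ?thesis using \<open>n > 0\<close> by (simp add: qint_def)
qed

lemma qint_Suc_split:
  assumes "w \<noteq> 0" "k \<le> n"
  shows "qint w (Suc n) = inverse w ^ Suc k * qint w (n - k) + w ^ (n - k) * qint w (Suc k)"
proof -
  have "x ^ Suc n = x ^ (n - k) * x ^ Suc k" for x :: ratfun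
    using assms(2) by (simp add: power_add[symmetric])
  moreover have "w ^ k * inverse w ^ k = 1"
    using assms(1) by (simp add: power_mult_distrib[symmetric])
  ultimately show ?thesis
    unfolding qint_def
    by (simp only: times_divide_eq_right add_divide_distrib[symmetric])
       (simp add: algebra_simps)
qed

definition qbinomial :: "ratfun \<Rightarrow> nat \<Rightarrow> nat \<Rightarrow> ratfun" where
  "qbinomial c n k = (if k \<le> n then qfact c n / (qfact c k * qfact c (n - k)) else 0)"

lemma qfact_Suc: "qfact c (Suc n) = qfact c n * qint c (Suc n)"
  by (simp add: qfact_def)

lemma qfact_nonzero:
  assumes "c \<noteq> 0" "\<And>n. n > 0 \<Longrightarrow> c ^ (2 * n) \<noteq> 1"
  shows "qfact c n \<noteq> 0"
  using qint_nonzero[OF assms] by (simp add: qfact_def)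

lemma qbinomial_Suc_Suc:
  assumes "c \<noteq> 0" "\<And>n. n > 0 \<Longrightarrow> c ^ (2 * n) \<noteq> 1"
  shows "qbinomial c (Suc n) (Suc k) = inverse c ^ Suc k * qbinomial c n (Suc k) + c ^ (n - k) * qbinomial c n k"
proof (cases "k < n")
  case True
  then obtain l where l: "n - k = Suc l" "n - Suc k = l" "n = Suc (k + l)"
    by (metis Suc_diff_Suc add_diff_cancel_left' add_Suc_right less_imp_Suc_add)
  note nz = qfact_nonzero[OF assms] qint_nonzero[OF assms]
  have "qint c (Suc n) = inverse c ^ Suc k * qint c (Suc l) + c ^ Suc l * qint c (Suc k)"
    using qint_Suc_split[of c k n] assms(1) True l by simp
  then show ?thesis
    using True nz[of "Suc l"] nz[of "Suc k"] nz[of l] nz[of k]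
    by (simp add: qbinomial_def l(1,2) qfact_Suc[of c n] qfact_Suc[of c k] qfact_Suc[of c l] divide_simps del: power_Suc)
       (simp add: algebra_simps del: power_Suc)
next
  case False
  have "qbinomial c m m = 1" for m
    using qfact_nonzero[OF assms] by (simp add: qbinomial_def qfact_def)
  moreover have "qbinomial c m l = 0" if "m < l" for m l
    using that by (simp add: qbinomial_def)
  ultimately show ?thesis using False
    by (cases "k = n") auto
qed

text \<open>The iterated commutator is a product of commuting operators
  \<open>L - u * w ^ (2 * l) * R\<close> with \<open>l < n\<close>, where \<open>L\<close> and
  \<open>R\<close> are left and right multiplication by \<open>f\<close>; this is the Gaussian
  binomial theorem for it. \<open>B\<close> stands for the quantum binomials, known here only
  through the Pascal rule, and \<open>w ^ n / w\<close> avoids the exponent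
  \<open>n - 1\<close>.\<close>

lemma (in bilinear_algebra) qad_expand_aux:
  assumes "\<And>n. B n 0 = 1" "\<And>n k. n < k \<Longrightarrow> B n k = 0"
    "\<And>n k. B (Suc n) (Suc k) = inverse w ^ Suc k * B n (Suc k) + w ^ (n - k) * B n k" "w \<noteq> 0"
  shows "qad w u f x n = (\<Sum>k\<le>n. ((- 1) ^ k * (u * w ^ n / w) ^ k * B n k) *s (f ^ (n - k) * x * f ^ k))"
proof (induction n)
  case 0
  then show ?case by (simp add: assms)
next
  case (Suc n)
  define c where "c n k = (- 1) ^ k * (u * w ^ n / w) ^ k * B n k" for n k
  have c0: "c n 0 = 1" for n by (simp add: c_def assms)
  have rec: "c (Suc n) (Suc k) = c n (Suc k) - u * w ^ (2 * n) * c n k" if "k \<le> n" for k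
  proof -
    have e: "w ^ n = w ^ (n - k) * w ^ k" using that by (simp add: power_add[symmetric])
    have "w ^ (2 * n) * (w ^ n / w) ^ k = w ^ n * w ^ (n - k) * ((w ^ n) ^ k)"
      using \<open>w \<noteq> 0\<close> e by (simp add: power_divide mult_2 power_add)
    moreover have "u * w ^ (2 * n) * (u * w ^ n / w) ^ k = u * u ^ k * (w ^ (2 * n) * (w ^ n / w) ^ k)"
      by (simp only: times_divide_eq_right[symmetric] power_mult_distrib mult_ac)
    ultimately have 1: "u * w ^ (2 * n) * (u * w ^ n / w) ^ k = (u * w ^ n) ^ Suc k * w ^ (n - k)"
      by (simp only: power_mult_distrib power_Suc mult_ac)
    have 2: "(u * w ^ Suc n / w) ^ Suc k * inverse w ^ Suc k = (u * w ^ n / w) ^ Suc k"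
    proof -
      have "u * w ^ Suc n / w * inverse w = u * w ^ n / w"
        using \<open>w \<noteq> 0\<close> by (simp add: divide_inverse)
      then show ?thesis by (simp only: power_mult_distrib[symmetric])
    qed
    have 3: "u * w ^ Suc n / w = u * w ^ n" using \<open>w \<noteq> 0\<close> by simp
    have "c (Suc n) (Suc k) = (- 1) ^ Suc k * ((u * w ^ Suc n / w) ^ Suc k * inverse w ^ Suc k * B n (Suc k)
       + (u * w ^ Suc n / w) ^ Suc k * w ^ (n - k) * B n k)"
      by (simp only: c_def assms distrib_left mult_ac)
    also have "\<dots> = (- 1) ^ Suc k * ((u * w ^ n / w) ^ Suc k * B n (Suc k)
       + u * w ^ (2 * n) * (u * w ^ n / w) ^ k * B n k)"
      unfolding 2 unfolding 3 1 ..
    also have "\<dots> = c n (Suc k) - u * w ^ (2 * n) * c n k"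
      by (simp add: c_def algebra_simps)
    finally show ?thesis .
  qed
  have f: "f * f ^ (n - k) = f ^ (Suc n - k)" if "k \<le> n" for k
    using that by (simp add: Suc_diff_le)
  have last: "c n (Suc n) = 0" by (simp add: c_def assms)
  have "qad w u f x (Suc n) = (\<Sum>k\<le>n. c n k *s (f ^ (Suc n - k) * x * f ^ k))
      - (\<Sum>k\<le>n. (u * w ^ (2 * n) * c n k) *s (f ^ (n - k) * x * f ^ Suc k))"
    unfolding qad.simps Suc c_def[symmetric]
    by (simp add: sum_distrib_left sum_distrib_right scale_sum_right mult.assoc f[symmetric] power_commutes)
  also have "(\<Sum>k\<le>n. c n k *s (f ^ (Suc n - k) * x * f ^ k)) = (\<Sum>k\<le>Suc n. c n k *s (f ^ (Suc n - k) * x * f ^ k))"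
    by (simp add: last)
  also have "\<dots> = f ^ Suc n * x + (\<Sum>k\<le>n. c n (Suc k) *s (f ^ (n - k) * x * f ^ Suc k))"
    by (subst sum.atMost_Suc_shift) (simp add: c0)
  also have "\<dots> - (\<Sum>k\<le>n. (u * w ^ (2 * n) * c n k) *s (f ^ (n - k) * x * f ^ Suc k))
      = f ^ Suc n * x + (\<Sum>k\<le>n. (c n (Suc k) - u * w ^ (2 * n) * c n k) *s (f ^ (n - k) * x * f ^ Suc k))"
    by (simp only: scale_left_diff_distrib sum_subtractf add_diff_eq)
  also have "\<dots> = f ^ Suc n * x + (\<Sum>k\<le>n. c (Suc n) (Suc k) *s (f ^ (n - k) * x * f ^ Suc k))"
    by (simp add: rec)
  also have "\<dots> = (\<Sum>k\<le>Suc n. c (Suc n) k *s (f ^ (Suc n - k) * x * f ^ k))"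
    by (subst sum.atMost_Suc_shift) (simp add: c0)
  finally show ?case unfolding c_def .
qed

text \<open>In degree \<open>m + 1\<close> the base of the powers in \<open>qad_expand_aux\<close>
  is \<open>u * w ^ m = 1\<close>, so an alternating sum of quantum binomials remains. Reversing the
  order of summation gives the sign.\<close>

lemma qad_eq_serre:
  fixes scale :: "ratfun \<Rightarrow> 'a::ring_1 \<Rightarrow> 'a" (infixr \<open>*s\<close> 75)
  assumes "bilinear_algebra scale" and w: "w \<noteq> 0" "\<And>n. n > 0 \<Longrightarrow> w ^ (2 * n) \<noteq> 1"
    and u: "u * w ^ m = 1"
  defines "M \<equiv> Suc m"
  shows "bilinear_algebra.qad scale w u f x M = ((- 1) ^ M * qfact w M) *s
    (\<Sum>n=0..M. ((- 1) ^ n * inverse (qfact w n) * inverse (qfact w (M - n))) *s (f ^ n * x * f ^ (M - n)))"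
proof -
  interpret bilinear_algebra scale by fact
  have uw: "u * w ^ M / w = 1" using w u by (simp add: M_def)
  have "qad w u f x M = (\<Sum>k\<le>M. ((- 1) ^ k * (u * w ^ M / w) ^ k * qbinomial w M k) *s (f ^ (M - k) * x * f ^ k))"
    by (rule qad_expand_aux)
       (use w qbinomial_Suc_Suc[OF w] qfact_nonzero[OF w] in \<open>auto simp: qbinomial_def qfact_def\<close>)
  also have "\<dots> = (\<Sum>k\<le>M. ((- 1) ^ k * (qfact w M * inverse (qfact w k) * inverse (qfact w (M - k)))) *s (f ^ (M - k) * x * f ^ k))"
    unfolding uw by (intro sum.cong refl arg_cong2[where f = scale]) (auto simp: qbinomial_def divide_inverse)
  also have "\<dots> = (\<Sum>n=0..M. ((- 1) ^ (M - n) * (qfact w M * inverse (qfact w (M - n)) * inverse (qfact w n))) *s (f ^ n * x * f ^ (M - n)))"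
    by (rule sum.reindex_bij_witness[of _ "\<lambda>n. M - n" "\<lambda>n. M - n"]) auto
  also have "\<dots> = ((- 1) ^ M * qfact w M) *s
    (\<Sum>n=0..M. ((- 1) ^ n * inverse (qfact w n) * inverse (qfact w (M - n))) *s (f ^ n * x * f ^ (M - n)))"
    unfolding scale_sum_right scale_scale
  proof (intro sum.cong refl arg_cong2[where f = scale])
    fix n assume "n \<in> {0..M}"
    then have "(- 1) ^ (M - n) = (- 1) ^ M * ((- 1) ^ n :: ratfun)"
      by (auto simp: minus_one_power_iff)
    then show "(- 1) ^ (M - n) * (qfact w M * inverse (qfact w (M - n)) * inverse (qfact w n)) =
       (- 1) ^ M * qfact w M * ((- 1) ^ n * inverse (qfact w n) * inverse (qfact w (M - n)))"
      by simp
  qed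
  finally show ?thesis .
qed

section \<open>Noncommutative polynomials\<close>

definition ncscale :: "'k::field \<Rightarrow> ('g, 'k) ncpoly \<Rightarrow> ('g, 'k) ncpoly" where
  "ncscale c p = nconst c * p"

definition ncmono :: "'g list \<Rightarrow> ('g, 'k::field) ncpoly" where
  "ncmono w = Poly_Mapping.single (Word w) 1"

lemma lookup_ncscale [simp]: "Poly_Mapping.lookup (ncscale c p) w = c * Poly_Mapping.lookup p w"
  by (simp add: ncscale_def nconst_def mult_map_scale_conv_mult[symmetric] Poly_Mapping.map.rep_eq when_def)

lemma nconst_central: "p * nconst c = nconst c * (p :: ('g, 'k::field) ncpoly)"
proof (induction p rule: update_induct)
  case const
  then show ?case by simp
next
  case (update f a b)
  have "Poly_Mapping.update a b f = f + Poly_Mapping.single a b"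
    using update(1) by (intro poly_mapping_eqI)
      (auto simp: lookup_update lookup_add lookup_single when_def not_in_keys_iff_lookup_eq_zero)
  then show ?case
    using update by (simp add: distrib_left distrib_right nconst_def mult_single mult.commute)
qed

interpretation nc: bilinear_algebra "ncscale :: 'k::field \<Rightarrow> ('g, 'k) ncpoly \<Rightarrow> _"
proof unfold_locales
  fix c d :: 'k and p q :: "('g, 'k) ncpoly"
  show "ncscale c p * q = ncscale c (p * q)" by (simp add: ncscale_def mult.assoc)
  show "p * ncscale c q = ncscale c (p * q)"
    by (simp add: ncscale_def mult.assoc[symmetric] nconst_central)
qed (auto simp: ncscale_def algebra_simps nconst_def single_add mult.assoc[symmetric] mult_single)

lemma ncmono_Nil: "ncmono [] = 1"
  by (simp add: ncmono_def zero_free_word_def[symmetric])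

lemma ncmono_append: "ncmono (u @ w) = ncmono u * ncmono w"
  by (simp add: ncmono_def mult_single plus_free_word_def)

lemma ncmono_Cons: "ncmono (g # w) = ngen g * ncmono w"
  by (simp add: ncmono_def ngen_def mult_single plus_free_word_def)

lemma ncpoly_expand: "(p :: ('g, 'k::field) ncpoly) =
    (\<Sum>w\<in>Poly_Mapping.keys p. ncscale (Poly_Mapping.lookup p w) (ncmono (letters w)))"
  by (rule poly_mapping_eqI)
     (auto simp: lookup_sum ncmono_def lookup_single when_def if_distrib sum.delta' not_in_keys_iff_lookup_eq_zero cong: if_cong)

lemma ncpoly_induct [case_names zero add scale mono]:
  assumes "P 0" "\<And>p q. P p \<Longrightarrow> P q \<Longrightarrow> P (p + q)" "\<And>c p. P p \<Longrightarrow> P (ncscale c p)" "\<And>w. P (ncmono w)"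
  shows "P (p :: ('g, 'k::field) ncpoly)"
proof -
  have "P (\<Sum>w\<in>A. ncscale (f w) (ncmono (letters w)))" for A and f :: "'g free_word \<Rightarrow> 'k"
    by (induction A rule: infinite_finite_induct) (auto intro: assms)
  then show ?thesis using ncpoly_expand[of p] by metis
qed

section \<open>Linear extension from words and evaluation homomorphisms\<close>

context bilinear_algebra
begin

definition linext :: "('g list \<Rightarrow> 'a) \<Rightarrow> ('g, 'k) ncpoly \<Rightarrow> 'a" where
  "linext f p = (\<Sum>w\<in>Poly_Mapping.keys p. Poly_Mapping.lookup p w *s (f (letters w)))"

lemma linext_superset:
  assumes "finite A" "Poly_Mapping.keys p \<subseteq> A"
  shows "linext f p = (\<Sum>w\<in>A. Poly_Mapping.lookup p w *s (f (letters w)))"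
  unfolding linext_def using assms
  by (intro sum.mono_neutral_left) (auto simp: not_in_keys_iff_lookup_eq_zero)

lemma linext_add [simp]: "linext f (p + q) = linext f p + linext f q"
proof -
  let ?A = "Poly_Mapping.keys p \<union> Poly_Mapping.keys q"
  have "linext f r = (\<Sum>w\<in>?A. Poly_Mapping.lookup r w *s (f (letters w)))" if "r \<in> {p, q, p + q}" for r
    using that Poly_Mapping.keys_add[of p q] by (intro linext_superset) auto
  then show ?thesis by (simp add: lookup_add scale_left_distrib sum.distrib)
qed

lemma linext_scale [simp]: "linext f (ncscale c p) = c *s linext f p"
proof -
  have "linext f (ncscale c p) = (\<Sum>w\<in>Poly_Mapping.keys p. Poly_Mapping.lookup (ncscale c p) w *s (f (letters w)))"
    by (rule linext_superset) (auto simp: in_keys_iff)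
  then show ?thesis by (simp add: linext_def scale_sum_right)
qed

lemma linext_mono [simp]: "linext f (ncmono w) = f w"
  by (simp add: linext_def ncmono_def)

lemma linext_0 [simp]: "linext f 0 = 0"
  by (simp add: linext_def)

lemma linext_minus [simp]: "linext f (- p) = - linext f p"
  using linext_add[of f p "- p"] by (simp add: eq_neg_iff_add_eq_0 add.commute)

lemma linext_diff [simp]: "linext f (p - q) = linext f p - linext f q"
  using linext_add[of f p "- q"] by simp

lemma linext_sum: "linext f (sum p A) = (\<Sum>i\<in>A. linext f (p i))"
  by (induction A rule: infinite_finite_induct) auto

definition alghom :: "('g \<Rightarrow> 'a) \<Rightarrow> ('g, 'k) ncpoly \<Rightarrow> 'a" where
  "alghom x = linext (\<lambda>w. prod_list (map x w))"

lemma alghom_add [simp]: "alghom x (p + q) = alghom x p + alghom x q"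
  and alghom_diff [simp]: "alghom x (p - q) = alghom x p - alghom x q"
  and alghom_minus [simp]: "alghom x (- p) = - alghom x p"
  and alghom_0 [simp]: "alghom x 0 = 0"
  and alghom_scale [simp]: "alghom x (ncscale c p) = c *s alghom x p"
  and alghom_mono: "alghom x (ncmono w) = prod_list (map x w)"
  and alghom_sum: "alghom x (sum f A) = (\<Sum>i\<in>A. alghom x (f i))"
  by (simp_all add: alghom_def linext_sum)

lemma alghom_mult [simp]: "alghom x (p * q) = alghom x p * alghom x q"
proof (induction p rule: ncpoly_induct)
  case (mono w)
  show ?case
  proof (induction q rule: ncpoly_induct)
    case (mono v)
    then show ?case by (simp add: ncmono_append[symmetric] alghom_mono)
  qed (simp_all add: distrib_left)
qed (simp_all add: distrib_right)

lemma alghom_1 [simp]: "alghom x 1 = 1"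
  using alghom_mono[of x "[]"] by (simp add: ncmono_Nil)

lemma alghom_gen [simp]: "alghom x (ngen g) = x g"
  using alghom_mono[of x "[g]"] by (simp add: ncmono_Cons ncmono_Nil)

lemma alghom_power [simp]: "alghom x (p ^ n) = alghom x p ^ n"
  by (induction n) auto

lemma alghom_nconst [simp]: "alghom x (nconst c) = c *s 1"
  using alghom_scale[of x c 1] by (simp add: ncscale_def)

end

section \<open>Linear endomorphisms of a free algebra\<close>

text \<open>As a type, the linear endomorphisms form an instance of \<open>ring_1\<close> and of
  \<open>bilinear_algebra\<close>, so commutators and continuants of operators fall under the
  general lemmas.\<close>

typedef (overloaded) ('g, 'k) ncend =
  "{f :: ('g, 'k::field) ncpoly \<Rightarrow> ('g, 'k) ncpoly.
      (\<forall>p q. f (p + q) = f p + f q) \<and> (\<forall>c p. f (ncscale c p) = ncscale c (f p))}"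
  morphisms app Abs_ncend
  by (rule exI[of _ id]) simp

setup_lifting type_definition_ncend

lemma app_add [simp]: "app f (p + q) = app f p + app f q"
  and app_scale [simp]: "app f (ncscale c p) = ncscale c (app f p)"
  using app[of f] by auto

lemma app_0 [simp]: "app f 0 = 0"
  using app_add[of f 0 0] by simp

lemma app_minus [simp]: "app f (- p) = - app f p"
  using app_add[of f p "- p"] by (simp add: eq_neg_iff_add_eq_0 add.commute)

lemma app_eqI: "(\<And>p. app f p = app g p) \<Longrightarrow> f = g"
  by (simp add: app_inject[symmetric] fun_eq_iff)

lemma app_eq_monoI:
  assumes "\<And>w. app f (ncmono w) = app g (ncmono w)" shows "f = g"
proof (rule app_eqI)
  show "app f p = app g p" for p
    by (induction p rule: ncpoly_induct) (simp_all add: assms)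
qed

instantiation ncend :: (type, field) ring_1
begin

lift_definition zero_ncend :: "('a, 'b) ncend" is "\<lambda>_. 0" by simp
lift_definition one_ncend :: "('a, 'b) ncend" is "\<lambda>p. p" by simp
lift_definition plus_ncend :: "('a, 'b) ncend \<Rightarrow> ('a, 'b) ncend \<Rightarrow> ('a, 'b) ncend"
  is "\<lambda>f g p. f p + g p" by (simp add: algebra_simps)
lift_definition minus_ncend :: "('a, 'b) ncend \<Rightarrow> ('a, 'b) ncend \<Rightarrow> ('a, 'b) ncend"
  is "\<lambda>f g p. f p - g p" by (simp add: algebra_simps)
lift_definition uminus_ncend :: "('a, 'b) ncend \<Rightarrow> ('a, 'b) ncend"
  is "\<lambda>f p. - f p" by (simp add: algebra_simps)
lift_definition times_ncend :: "('a, 'b) ncend \<Rightarrow> ('a, 'b) ncend \<Rightarrow> ('a, 'b) ncend"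
  is "\<lambda>f g p. f (g p)" by simp

instance
proof
  show "(0 :: ('a, 'b) ncend) \<noteq> 1"
    by transfer (metis zero_neq_one)
qed (transfer; simp add: fun_eq_iff algebra_simps)+

end

lift_definition endscale :: "'k::field \<Rightarrow> ('g, 'k) ncend \<Rightarrow> ('g, 'k) ncend"
  is "\<lambda>c f p. ncscale c (f p)" by (simp add: algebra_simps)

lemma app_simps [simp]:
  "app 0 p = 0" "app 1 p = p" "app (f + g) p = app f p + app g p" "app (f - g) p = app f p - app g p"
  "app (- f) p = - app f p" "app (f * g) p = app f (app g p)" "app (endscale c f) p = ncscale c (app f p)"
  by (transfer; simp)+

interpretation en: bilinear_algebra "endscale :: 'k::field \<Rightarrow> ('g, 'k) ncend \<Rightarrow> _"
  by unfold_locales (rule app_eqI; simp add: algebra_simps)+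

definition linend :: "('g list \<Rightarrow> ('g, 'k::field) ncpoly) \<Rightarrow> ('g, 'k) ncend" where
  "linend f = Abs_ncend (nc.linext f)"

lemma app_linend: "app (linend f) p = nc.linext f p"
  unfolding linend_def by (subst Abs_ncend_inverse) auto

lemma app_linend_mono [simp]: "app (linend f) (ncmono w) = f w"
  by (simp add: app_linend)

definition lmult :: "'g \<Rightarrow> ('g, 'k::field) ncend" where
  "lmult g = linend (\<lambda>w. ncmono (g # w))"

lemma app_lmult [simp]: "app (lmult g) p = ngen g * p"
  by (induction p rule: ncpoly_induct) (simp_all add: lmult_def ncmono_Cons distrib_left)

section \<open>Presented algebras\<close>

text \<open>This is the ideal in all noncommutative polynomials, with arbitrary letters in
  \<open>a\<close> and \<open>b\<close>, so that its closure properties carry no carrier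
  conditions.\<close>

inductive_set two_sided :: "('g, 'k::field) ncpoly set \<Rightarrow> ('g, 'k) ncpoly set" for R where
  zero: "0 \<in> two_sided R"
| add: "p \<in> two_sided R \<Longrightarrow> q \<in> two_sided R \<Longrightarrow> p + q \<in> two_sided R"
| base: "r \<in> R \<Longrightarrow> a * r * b \<in> two_sided R"

lemma two_sided_algebra_ideal: "algebra_ideal ncscale (two_sided R)"
proof unfold_locales
  show "a * p \<in> two_sided R" if "p \<in> two_sided R" for a p
    using that
  proof induction
    case (base r x y)
    then show ?case using two_sided.base[of r R "a * x" y] by (simp add: mult.assoc)
  qed (auto simp: distrib_left intro: two_sided.intros)
  show "p * a \<in> two_sided R" if "p \<in> two_sided R" for a p
    using that
  proof induction
    case (base r x y)
    then show ?case using two_sided.base[of r R x "y * a"] by (simp add: mult.assoc)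
  qed (auto simp: distrib_right intro: two_sided.intros)
qed (auto intro: two_sided.intros)

lemma two_sided_rel: "r \<in> R \<Longrightarrow> r \<in> two_sided R"
  using two_sided.base[of r R 1 1] by simp

section \<open>Polynomials in a given set of letters\<close>

abbreviation fcarrier :: "'g set \<Rightarrow> ('g, 'k::field) ncpoly set" where
  "fcarrier G \<equiv> carrier (free_algebra G)"

lemma free_algebra_simps:
  "mult (free_algebra G) = (*)" "one (free_algebra G) = 1" "zero (free_algebra G) = 0"
  "add (free_algebra G) = (+)" "smult (free_algebra G) = ncscale"
  by (simp_all add: free_algebra_def ncscale_def fun_eq_iff)

lemma fcarrier_iff: "p \<in> fcarrier G \<longleftrightarrow> (\<forall>w\<in>Poly_Mapping.keys p. set (letters w) \<subseteq> G)"
  by (simp add: free_algebra_def)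

lemma fcarrier_add: "p \<in> fcarrier G \<Longrightarrow> q \<in> fcarrier G \<Longrightarrow> p + q \<in> fcarrier G"
  and fcarrier_mult: "p \<in> fcarrier G \<Longrightarrow> q \<in> fcarrier G \<Longrightarrow> p * q \<in> fcarrier G"
  and fcarrier_1: "1 \<in> fcarrier G" and fcarrier_0: "0 \<in> fcarrier G"
proof -
  interpret ring "free_algebra G" by (rule ring_free_algebra)
  show "p \<in> fcarrier G \<Longrightarrow> q \<in> fcarrier G \<Longrightarrow> p + q \<in> fcarrier G"
    using a_closed[of p q] by (simp add: free_algebra_simps)
  show "p \<in> fcarrier G \<Longrightarrow> q \<in> fcarrier G \<Longrightarrow> p * q \<in> fcarrier G"
    using m_closed[of p q] by (simp add: free_algebra_simps)
  show "1 \<in> fcarrier G" "0 \<in> fcarrier G"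
    using one_closed zero_closed by (simp_all add: free_algebra_simps)
qed

lemma fcarrier_uminus: "p \<in> fcarrier G \<Longrightarrow> - p \<in> fcarrier G"
  by (simp add: fcarrier_iff)

lemma fcarrier_diff: "p \<in> fcarrier G \<Longrightarrow> q \<in> fcarrier G \<Longrightarrow> p - q \<in> fcarrier G"
  using fcarrier_add[OF _ fcarrier_uminus] by fastforce

lemma fcarrier_nconst: "nconst c \<in> fcarrier G"
  by (simp add: fcarrier_iff nconst_def zero_free_word_def)

lemma fcarrier_scale: "p \<in> fcarrier G \<Longrightarrow> ncscale c p \<in> fcarrier G"
  by (simp add: ncscale_def fcarrier_mult fcarrier_nconst)

lemma fcarrier_gen: "g \<in> G \<Longrightarrow> ngen g \<in> fcarrier G"
  by (simp add: fcarrier_iff ngen_def)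

lemma fcarrier_power: "p \<in> fcarrier G \<Longrightarrow> p ^ n \<in> fcarrier G"
  by (induction n) (auto intro: fcarrier_mult fcarrier_1)

lemma fcarrier_sum: "(\<And>i. i \<in> A \<Longrightarrow> f i \<in> fcarrier G) \<Longrightarrow> sum f A \<in> fcarrier G"
  by (induction A rule: infinite_finite_induct) (auto intro: fcarrier_add fcarrier_0)

lemmas fcarrier_intros = fcarrier_add fcarrier_mult fcarrier_1 fcarrier_0 fcarrier_uminus fcarrier_diff
  fcarrier_nconst fcarrier_scale fcarrier_gen fcarrier_power fcarrier_sum

lemma fcarrier_alghom:
  assumes "p \<in> fcarrier G" "\<And>g. g \<in> G \<Longrightarrow> x g \<in> fcarrier H"
  shows "nc.alghom x p \<in> fcarrier H"
  unfolding nc.alghom_def nc.linext_def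
proof (intro fcarrier_intros)
  fix w assume "w \<in> Poly_Mapping.keys p"
  then have "set (letters w) \<subseteq> G" using assms(1) by (simp add: fcarrier_iff)
  moreover have "set v \<subseteq> G \<Longrightarrow> prod_list (map x v) \<in> fcarrier H" for v
    by (induction v) (auto intro: fcarrier_intros assms)
  ultimately show "prod_list (map x (letters w)) \<in> fcarrier H" by blast
qed

text \<open>The inclusion from right to left uses the retraction that sends the generators outside of \<open>G\<close> to \<open>0\<close>.\<close>

lemma genideal_free_algebra:
  assumes "R \<subseteq> fcarrier G"
  shows "Idl\<^bsub>free_algebra G\<^esub> R = two_sided R \<inter> fcarrier G"
proof
  interpret ring "free_algebra G" by (rule ring_free_algebra)
  interpret ts: algebra_ideal ncscale "two_sided R" by (rule two_sided_algebra_ideal)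
  have "subgroup (two_sided R \<inter> fcarrier G) (add_monoid (free_algebra G))"
  proof (rule add.subgroupI)
    show "two_sided R \<inter> fcarrier G \<noteq> {}"
      using ts.zero_mem fcarrier_0 by blast
    fix p q :: "('a, 'b) ncpoly" assume pq: "p \<in> two_sided R \<inter> fcarrier G" "q \<in> two_sided R \<inter> fcarrier G"
    then show "p \<oplus>\<^bsub>free_algebra G\<^esub> q \<in> two_sided R \<inter> fcarrier G"
      by (auto simp: free_algebra_simps intro: ts.add_mem fcarrier_add)
    have "\<ominus>\<^bsub>free_algebra G\<^esub> p = - p"
      using pq by (intro minus_equality) (auto simp: free_algebra_simps intro: fcarrier_uminus)
    then show "\<ominus>\<^bsub>free_algebra G\<^esub> p \<in> two_sided R \<inter> fcarrier G"
      using pq by (auto intro: ts.minus_mem fcarrier_uminus)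
  qed auto
  then have "ideal (two_sided R \<inter> fcarrier G) (free_algebra G)"
    by (rule idealI[OF ring_free_algebra])
       (auto simp: free_algebra_simps intro: ts.mult_left_mem ts.mult_right_mem fcarrier_mult)
  then show "Idl\<^bsub>free_algebra G\<^esub> R \<subseteq> two_sided R \<inter> fcarrier G"
    using assms by (intro genideal_minimal) (auto intro: two_sided_rel)
  interpret I: ideal "Idl\<^bsub>free_algebra G\<^esub> R" "free_algebra G"
    by (rule genideal_ideal[OF assms])
  define \<pi> :: "('a, 'b) ncpoly \<Rightarrow> ('a, 'b) ncpoly"
    where "\<pi> = nc.alghom (\<lambda>g. if g \<in> G then ngen g else 0)"
  have \<pi>_carrier: "\<pi> p \<in> fcarrier G" for p
    unfolding \<pi>_def by (rule fcarrier_alghom[of _ UNIV]) (auto simp: fcarrier_iff[of _ UNIV] intro: fcarrier_intros)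
  have \<pi>_id: "\<pi> p = p" if "p \<in> fcarrier G" for p
  proof -
    have "set v \<subseteq> G \<Longrightarrow> prod_list (map (\<lambda>g. if g \<in> G then ngen g else 0) v) = ncmono v" for v
      by (induction v) (auto simp: ncmono_Nil ncmono_Cons)
    then show ?thesis
      using that unfolding \<pi>_def nc.alghom_def nc.linext_def fcarrier_iff
      by (intro trans[OF sum.cong ncpoly_expand[symmetric]]) auto
  qed
  have "\<pi> p \<in> Idl\<^bsub>free_algebra G\<^esub> R" if "p \<in> two_sided R" for p
    using that
  proof induction
    case zero
    then show ?case using I.zero_closed by (simp add: \<pi>_def free_algebra_simps)
  next
    case (add p q)
    then show ?case using I.a_closed[of "\<pi> p" "\<pi> q"] by (simp add: \<pi>_def free_algebra_simps)
  next
    case (base r a b)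
    then have r: "r \<in> Idl\<^bsub>free_algebra G\<^esub> R" "\<pi> r = r"
      using genideal_self[OF assms] \<pi>_id assms by auto
    have "\<pi> (a * r * b) = \<pi> a * \<pi> r * \<pi> b" by (simp add: \<pi>_def)
    then show ?case
      using I.I_r_closed[OF I.I_l_closed[OF r(1) \<pi>_carrier] \<pi>_carrier, of a b] r
      by (simp add: free_algebra_simps)
  qed
  then show "two_sided R \<inter> fcarrier G \<subseteq> Idl\<^bsub>free_algebra G\<^esub> R"
    using \<pi>_id by force
qed

section \<open>Classes of polynomials in a presented algebra\<close>

definition pclass :: "'g set \<Rightarrow> ('g, 'k::field) ncpoly set \<Rightarrow> ('g, 'k) ncpoly \<Rightarrow> ('g, 'k) ncpoly set" where
  "pclass G R p = (Idl\<^bsub>free_algebra G\<^esub> R) +>\<^bsub>free_algebra G\<^esub> p"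

lemma presented_gen_eq: "presented_gen G R g = pclass G R (ngen g)"
  by (simp add: presented_gen_def pclass_def Let_def)

locale presentation =
  fixes G :: "'g set" and R :: "('g, 'k::field) ncpoly set"
  assumes rels: "R \<subseteq> fcarrier G"
begin

abbreviation "pres \<equiv> presented_algebra G R"
abbreviation "cls \<equiv> pclass G R"

sublocale I: ideal "Idl\<^bsub>free_algebra G\<^esub> R" "free_algebra G"
  by (rule ring.genideal_ideal[OF ring_free_algebra rels])

lemma cls_hom:
  assumes "p \<in> fcarrier G" "q \<in> fcarrier G"
  shows "cls p \<oplus>\<^bsub>pres\<^esub> cls q = cls (p + q)" "cls p \<otimes>\<^bsub>pres\<^esub> cls q = cls (p * q)"
  using I.a_rcos_sum[OF assms] I.rcoset_mult_add[OF assms]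
  by (simp_all add: presented_algebra_def pclass_def Let_def ring.defs module.defs FactRing_def free_algebra_simps)

lemma cls_1: "\<one>\<^bsub>pres\<^esub> = cls 1"
  by (simp add: presented_algebra_def pclass_def Let_def ring.defs module.defs FactRing_def free_algebra_simps)

lemma cls_0: "\<zero>\<^bsub>pres\<^esub> = cls 0"
  using I.a_coset_add_zero[of "Idl\<^bsub>free_algebra G\<^esub> R"] I.a_subset
  by (simp add: presented_algebra_def pclass_def Let_def ring.defs module.defs FactRing_def free_algebra_simps)

lemma carrier_pres: "carrier pres = cls ` fcarrier G"
  by (auto simp: presented_algebra_def pclass_def Let_def ring.defs module.defs FactRing_def A_RCOSETS_def' image_def)

lemma cls_eq_iff:
  assumes "p \<in> fcarrier G" "q \<in> fcarrier G"
  shows "cls p = cls q \<longleftrightarrow> p - q \<in> two_sided R"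
proof -
  have m: "p \<ominus>\<^bsub>free_algebra G\<^esub> q = p - q"
  proof -
    have "\<ominus>\<^bsub>free_algebra G\<^esub> q = - q"
      using assms by (intro I.minus_equality) (auto simp: free_algebra_simps intro: fcarrier_uminus)
    then show ?thesis by (simp add: a_minus_def free_algebra_simps)
  qed
  have "cls p = cls q \<longleftrightarrow> p - q \<in> Idl\<^bsub>free_algebra G\<^esub> R"
    using I.quotient_eq_iff_same_a_r_cos[OF I.ideal_axioms assms] unfolding m pclass_def by (rule sym)
  then show ?thesis
    using assms by (simp add: genideal_free_algebra[OF rels] fcarrier_diff)
qed

text \<open>Scalar multiplication on the quotient is a union over all representatives. They all give
  the same class, and a coset is nonempty, so the union collapses.\<close>

lemma cls_scale:
  assumes "p \<in> fcarrier G"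
  shows "c \<odot>\<^bsub>pres\<^esub> cls p = cls (ncscale c p)"
proof -
  interpret ts: algebra_ideal ncscale "two_sided R" by (rule two_sided_algebra_ideal)
  have "cls (ncscale c q) = cls (ncscale c p)" if q: "q \<in> cls p" for q
  proof -
    obtain h where "h \<in> Idl\<^bsub>free_algebra G\<^esub> R" "q = h + p"
      using q by (auto simp: pclass_def a_r_coset_def r_coset_def free_algebra_simps)
    then show ?thesis
      using assms genideal_free_algebra[OF rels]
      by (subst cls_eq_iff) (auto simp: nc.scale_right_distrib intro!: ts.scale_mem fcarrier_intros)
  qed
  moreover have "cls p \<noteq> {}"
    using I.a_rcos_self[OF assms] by (auto simp: pclass_def)
  ultimately have "(\<Union>q\<in>cls p. cls (ncscale c q)) = cls (ncscale c p)"
    by (simp cong: SUP_cong)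
  then show ?thesis
    by (simp add: presented_algebra_def Let_def ring.defs module.defs free_algebra_simps pclass_def[symmetric])
qed

lemma ring_pres: "ring pres"
proof (rule ringI)
  show "abelian_group pres"
  proof (rule abelian_groupI)
    fix x assume "x \<in> carrier pres"
    then obtain p where p: "p \<in> fcarrier G" "x = cls p" by (auto simp: carrier_pres)
    show "\<exists>y\<in>carrier pres. y \<oplus>\<^bsub>pres\<^esub> x = \<zero>\<^bsub>pres\<^esub>"
      using p by (intro bexI[of _ "cls (- p)"]) (simp_all add: cls_hom cls_0 carrier_pres fcarrier_uminus)
  qed (auto simp: carrier_pres cls_hom cls_0 fcarrier_intros add_ac)
  show "Group.monoid pres"
    by (rule monoidI) (auto simp: carrier_pres cls_hom cls_1 fcarrier_intros mult.assoc)
qed (auto simp: carrier_pres cls_hom fcarrier_intros distrib_left distrib_right)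

text \<open>The classes of polynomials in the \<open>x i\<close> form a subalgebra containing the
  generators, hence contain the intersection of all such subalgebras.\<close>

lemma generated_subalgebra_carrier:
  assumes x: "\<And>i. i \<in> A \<Longrightarrow> x i \<in> fcarrier G"
  shows "carrier (generated_subalgebra pres ((\<lambda>i. cls (x i)) ` A)) \<subseteq> (\<lambda>p. cls (nc.alghom x p)) ` fcarrier A"
proof -
  interpret P: ring pres by (rule ring_pres)
  let ?H = "(\<lambda>p. cls (nc.alghom x p)) ` fcarrier A"
  have xc: "nc.alghom x p \<in> fcarrier G" if "p \<in> fcarrier A" for p
    using fcarrier_alghom[OF that x] .
  have H: "cls (nc.alghom x r) \<in> ?H" if "r \<in> fcarrier A" for r
    using that by (rule imageI)
  have "subring ?H pres"
  proof (rule P.subringI)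
    show "?H \<subseteq> carrier pres" using xc by (auto simp: carrier_pres)
    show "\<one>\<^bsub>pres\<^esub> \<in> ?H" by (rule image_eqI[of _ _ 1]) (auto simp: cls_1 fcarrier_1)
    fix h k assume hk: "h \<in> ?H" "k \<in> ?H"
    then obtain p q where p: "h = cls (nc.alghom x p)" "k = cls (nc.alghom x q)" "p \<in> fcarrier A" "q \<in> fcarrier A"
      by auto
    have "h \<otimes>\<^bsub>pres\<^esub> k = cls (nc.alghom x (p * q))" "h \<oplus>\<^bsub>pres\<^esub> k = cls (nc.alghom x (p + q))"
      using p xc by (simp_all add: cls_hom)
    then show "h \<otimes>\<^bsub>pres\<^esub> k \<in> ?H" "h \<oplus>\<^bsub>pres\<^esub> k \<in> ?H"
      using H[OF fcarrier_mult[OF p(3,4)]] H[OF fcarrier_add[OF p(3,4)]] by (simp_all only:)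
    have "\<ominus>\<^bsub>pres\<^esub> h = cls (nc.alghom x (- p))"
      using p xc by (intro P.minus_equality) (auto simp: cls_hom cls_0 carrier_pres fcarrier_uminus)
    then show "\<ominus>\<^bsub>pres\<^esub> h \<in> ?H" using H[OF fcarrier_uminus[OF p(3)]] by (simp only:)
  qed
  moreover have "c \<odot>\<^bsub>pres\<^esub> h \<in> ?H" if h: "h \<in> ?H" for c h
  proof -
    obtain p where p: "h = cls (nc.alghom x p)" "p \<in> fcarrier A" using h by auto
    then have "c \<odot>\<^bsub>pres\<^esub> h = cls (nc.alghom x (ncscale c p))"
      using xc by (simp add: cls_scale)
    then show ?thesis using H[OF fcarrier_scale[OF p(2)]] by (simp only:)
  qed
  moreover have "cls (x i) \<in> ?H" if "i \<in> A" for i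
    using that by (intro image_eqI[of _ _ "ngen i"]) (auto intro: fcarrier_gen)
  ultimately show ?thesis
    unfolding generated_subalgebra_def subalgebra_of_def by auto
qed

end

text \<open>Every element of the subalgebra is the class of a polynomial in the \<open>x i\<close>;
  the map evaluates the same polynomial at the \<open>y i\<close>. Hypothesis \<open>rel\<close>
  makes it well defined.\<close>

lemma subalgebra_hom_exists:
  fixes x :: "'i \<Rightarrow> ('g, 'k::field) ncpoly" and y :: "'i \<Rightarrow> ('h, 'k) ncpoly"
  assumes "presentation G R" "presentation H S"
    and x: "\<And>i. i \<in> A \<Longrightarrow> x i \<in> fcarrier G" and y: "\<And>i. i \<in> A \<Longrightarrow> y i \<in> fcarrier H"
    and rel: "\<And>p. p \<in> fcarrier A \<Longrightarrow> nc.alghom x p \<in> two_sided R \<Longrightarrow> nc.alghom y p \<in> two_sided S"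
  shows "\<exists>\<phi> \<in> algebra_hom (generated_subalgebra (presented_algebra G R) ((\<lambda>i. pclass G R (x i)) ` A)) (presented_algebra H S).
     \<forall>i\<in>A. \<phi> (pclass G R (x i)) = pclass H S (y i)"
proof -
  interpret U: presentation G R by fact
  interpret T: presentation H S by fact
  let ?B = "generated_subalgebra U.pres ((\<lambda>i. U.cls (x i)) ` A)"
  have xc: "nc.alghom x p \<in> fcarrier G" and yc: "nc.alghom y p \<in> fcarrier H" if "p \<in> fcarrier A" for p
    using fcarrier_alghom[OF that] x y by blast+
  \<comment> \<open>An arbitrary representing polynomial is chosen; the next fact removes the
    dependence on the choice.\<close>
  define \<phi> where "\<phi> X = T.cls (nc.alghom y (SOME p. p \<in> fcarrier A \<and> X = U.cls (nc.alghom x p)))" for X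
  have \<phi>: "\<phi> (U.cls (nc.alghom x p)) = T.cls (nc.alghom y p)" if p: "p \<in> fcarrier A" for p
  proof -
    define q where "q = (SOME q. q \<in> fcarrier A \<and> U.cls (nc.alghom x p) = U.cls (nc.alghom x q))"
    have q: "q \<in> fcarrier A" "U.cls (nc.alghom x p) = U.cls (nc.alghom x q)"
      unfolding q_def using someI[of "\<lambda>q. q \<in> fcarrier A \<and> U.cls (nc.alghom x p) = U.cls (nc.alghom x q)" p] p by auto
    then have "nc.alghom x (q - p) \<in> two_sided R"
      using U.cls_eq_iff[OF xc[OF q(1)] xc[OF p]] by simp
    then have "nc.alghom y (q - p) \<in> two_sided S"
      by (rule rel[OF fcarrier_diff[OF q(1) p]])
    then show ?thesis
      using T.cls_eq_iff[OF yc[OF q(1)] yc[OF p]] by (simp add: \<phi>_def q_def)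
  qed
  have carrier: "\<exists>p\<in>fcarrier A. X = U.cls (nc.alghom x p)" if "X \<in> carrier ?B" for X
    using U.generated_subalgebra_carrier[of A x] x that by blast
  have ops: "mult ?B = mult U.pres" "add ?B = add U.pres" "one ?B = one U.pres" "smult ?B = smult U.pres"
    by (simp_all add: generated_subalgebra_def)
  have "\<phi> \<in> ring_hom ?B T.pres"
  proof (rule ring_hom_memI)
    fix X Y assume "X \<in> carrier ?B" "Y \<in> carrier ?B"
    then obtain p q where p: "p \<in> fcarrier A" "X = U.cls (nc.alghom x p)" and q: "q \<in> fcarrier A" "Y = U.cls (nc.alghom x q)"
      using carrier by blast
    show "\<phi> X \<in> carrier T.pres" using p yc by (auto simp: \<phi> T.carrier_pres)
    show "\<phi> (X \<otimes>\<^bsub>?B\<^esub> Y) = \<phi> X \<otimes>\<^bsub>T.pres\<^esub> \<phi> Y"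
      using p q \<phi>[OF fcarrier_mult[OF p(1) q(1)]] by (simp add: ops \<phi> U.cls_hom T.cls_hom xc yc)
    show "\<phi> (X \<oplus>\<^bsub>?B\<^esub> Y) = \<phi> X \<oplus>\<^bsub>T.pres\<^esub> \<phi> Y"
      using p q \<phi>[OF fcarrier_add[OF p(1) q(1)]] by (simp add: ops \<phi> U.cls_hom T.cls_hom xc yc)
  next
    show "\<phi> \<one>\<^bsub>?B\<^esub> = \<one>\<^bsub>T.pres\<^esub>"
      using \<phi>[OF fcarrier_1] by (simp add: ops U.cls_1 T.cls_1)
  qed
  moreover have "\<phi> (c \<odot>\<^bsub>?B\<^esub> X) = c \<odot>\<^bsub>T.pres\<^esub> \<phi> X" if X: "X \<in> carrier ?B" for c X
  proof -
    obtain p where p: "p \<in> fcarrier A" "X = U.cls (nc.alghom x p)"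
      using carrier[OF X] by blast
    then show ?thesis
      using \<phi>[OF fcarrier_scale[OF p(1)]] by (simp add: ops \<phi> U.cls_scale T.cls_scale xc yc)
  qed
  moreover have "\<phi> (U.cls (x i)) = T.cls (y i)" if "i \<in> A" for i
    using \<phi>[OF fcarrier_gen[OF that]] by simp
  ultimately show ?thesis unfolding algebra_hom_def by blast
qed

section \<open>A Verma module on the free algebra\<close>

lemma qv_power: "qv ^ n = Fract (Polynomial.monom 1 n) 1"
  by (induction n) (simp_all add: qv_def One_fract_def monom_Suc monom_0 one_pCons[symmetric])

lemma qv_nonzero: "qv \<noteq> 0"
  by (simp add: qv_def Zero_fract_def eq_fract)

lemma qv_power_neq_1: "n > 0 \<Longrightarrow> qv ^ n \<noteq> 1"
  by (simp add: qv_power One_fract_def eq_fract monom_eq_1_iff)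

locale cartan_datum =
  fixes N :: nat and C :: "nat \<Rightarrow> nat \<Rightarrow> int" and d :: "nat \<Rightarrow> nat"
  assumes gcm: "generalized_cartan_matrix N C" and sym: "is_symmetrizer N C d"
begin

definition vi :: "nat \<Rightarrow> ratfun" where "vi i = qv ^ d i"
definition vc :: "nat \<Rightarrow> nat \<Rightarrow> ratfun" where "vc i j = vi i powi C i j"
definition cm :: "nat \<Rightarrow> nat \<Rightarrow> nat" where "cm i j = nat (- C i j)"

lemma vi_nonzero [simp]: "vi i \<noteq> 0"
  by (simp add: vi_def qv_nonzero)

lemma vc_nonzero [simp]: "vc i j \<noteq> 0"
  by (simp add: vc_def)

lemma vi_power_neq_1: "i \<in> {1..N} \<Longrightarrow> n > 0 \<Longrightarrow> vi i ^ n \<noteq> 1"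
  using sym qv_power_neq_1[of "d i * n"] by (auto simp: vi_def power_mult[symmetric] is_symmetrizer_def)

lemma vc_diag: "i \<in> {1..N} \<Longrightarrow> vc i i = (vi i)\<^sup>2"
  using gcm by (simp add: vc_def generalized_cartan_matrix_def)

lemma vc_sym: "i \<in> {1..N} \<Longrightarrow> j \<in> {1..N} \<Longrightarrow> vc i j = vc j i"
  using sym by (simp add: vc_def vi_def is_symmetrizer_def power_int_power)

lemma vc_cm: "i \<in> {1..N} \<Longrightarrow> j \<in> {1..N} \<Longrightarrow> i \<noteq> j \<Longrightarrow> vc i j * vi i ^ cm i j = 1"
proof -
  assume "i \<in> {1..N}" "j \<in> {1..N}" "i \<noteq> j"
  then have "C i j = - int (cm i j)" using gcm by (auto simp: cm_def generalized_cartan_matrix_def)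
  then show ?thesis by (simp add: vc_def power_int_minus)
qed

text \<open>The eigenvalue of the inverse of \<open>K_i\<close> on a word, the empty word having
  weight 0.\<close>

definition wt :: "nat \<Rightarrow> nat list \<Rightarrow> ratfun" where
  "wt i w = prod_list (map (vc i) w)"

lemma wt_simps [simp]: "wt i [] = 1" "wt i (j # w) = vc i j * wt i w"
  by (simp_all add: wt_def)

lemma wt_nonzero [simp]: "wt i w \<noteq> 0"
  by (induction w) auto

text \<open>
  The operator \<open>q\<^sub>i = \<sigma>\<^sub>i E\<^sub>i K\<^sub>i\<^sup>-\<^sup>1\<close> of the module is fixed by \<open>q\<^sub>i 1 = 0\<close> and
  \<open>q\<^sub>i P\<^sub>j = v\<^sub>i\<^bsup>c\<^sub>i\<^sub>j\<^esup> P\<^sub>j q\<^sub>i + \<delta>\<^sub>i\<^sub>j (1 - v\<^sub>i\<^sup>2) (1 - K\<^sub>i\<^sup>-\<^sup>2)\<close>.  Its value on a word is kept as a list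
  of coefficients and shorter words, so that \<open>\<theta>\<close> can be defined by recursion on the length of words.
\<close>

primrec lower_terms :: "nat \<Rightarrow> nat list \<Rightarrow> (ratfun \<times> nat list) list" where
  "lower_terms i [] = []"
| "lower_terms i (j # w) = map (\<lambda>(c, x). (vc i j * c, j # x)) (lower_terms i w) @
     (if i = j then [((1 - (vi i)\<^sup>2) * (1 - (wt i w)\<^sup>2), w)] else [])"

lemma lower_terms_length: "(c, x) \<in> set (lower_terms i w) \<Longrightarrow> length x < length w"
  by (induction w arbitrary: c x) (auto split: if_splits)

definition Kinvop :: "nat \<Rightarrow> (nat, ratfun) ncend" where
  "Kinvop i = linend (\<lambda>w. ncscale (wt i w) (ncmono w))"

definition Kop :: "nat \<Rightarrow> (nat, ratfun) ncend" where
  "Kop i = linend (\<lambda>w. ncscale (inverse (wt i w)) (ncmono w))"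

definition qop :: "nat \<Rightarrow> (nat, ratfun) ncend" where
  "qop i = linend (\<lambda>w. \<Sum>(c, x)\<leftarrow>lower_terms i w. ncscale c (ncmono x))"

abbreviation "P \<equiv> lmult :: nat \<Rightarrow> (nat, ratfun) ncend"
abbreviation "ksq i \<equiv> Kinvop i * Kinvop i"

lemma app_Kinvop [simp]: "app (Kinvop i) (ncmono w) = ncscale (wt i w) (ncmono w)"
  by (simp add: Kinvop_def)

lemma app_Kop [simp]: "app (Kop i) (ncmono w) = ncscale (inverse (wt i w)) (ncmono w)"
  by (simp add: Kop_def)

lemma lmult_mono: "app (P j) (ncmono w) = ncmono (j # w)"
  by (simp add: ncmono_Cons)

lemma qop_Nil [simp]: "app (qop i) 1 = 0"
proof -
  have "app (qop i) (ncmono []) = 0" by (simp add: qop_def)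
  then show ?thesis by (simp add: ncmono_Nil)
qed

lemma Kop_Kinvop [simp]: "Kop i * Kinvop i = 1" "Kinvop i * Kop i = 1"
  by (rule app_eq_monoI; simp)+

lemma K_commute: "Kop i * Kop j = Kop j * Kop i"
  by (rule app_eq_monoI) (simp add: mult.commute)

lemma Kinvop_P: "Kinvop i * P j = endscale (vc i j) (P j * Kinvop i)"
  by (rule app_eq_monoI) (simp add: lmult_mono del: app_lmult)

lemma Kop_P: "Kop i * P j = endscale (inverse (vc i j)) (P j * Kop i)"
  by (rule app_eq_monoI) (simp add: lmult_mono mult.commute del: app_lmult)

lemma qop_P: "qop i * P j = endscale (vc i j) (P j * qop i)
   + (if i = j then endscale (1 - (vi i)\<^sup>2) (1 - ksq i) else 0)"
proof (rule app_eq_monoI)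
  fix w
  have "(\<Sum>(c, x)\<leftarrow>map (\<lambda>(c, x). (a * c, j # x)) l. ncscale c (ncmono x)) =
      ncscale a (app (P j) (\<Sum>(c, x)\<leftarrow>l. ncscale c (ncmono x)))" for l a
    by (induction l) (auto simp: nc.scale_right_distrib ncmono_Cons distrib_left)
  note shift = this[unfolded split_def]
  show "app (qop i * P j) (ncmono w) = app (endscale (vc i j) (P j * qop i)
   + (if i = j then endscale (1 - (vi i)\<^sup>2) (1 - ksq i) else 0)) (ncmono w)"
    by (simp add: qop_def lmult_mono split_def shift del: app_lmult map_map)
       (simp add: power2_eq_square nc.scale_right_diff_distrib nc.scale_left_diff_distrib left_diff_distrib right_diff_distrib)
qed

text \<open>The value of \<open>f\<close> at \<open>k # w\<close> is the value of
  \<open>f * P k\<close> at \<open>w\<close>; so operator identities follow by induction on words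
  from commutation relations with \<open>P k\<close>.\<close>

lemma ncend_eq_wordI:
  fixes f g :: "(nat, ratfun) ncend"
  assumes "app f 1 = app g 1"
    and "\<And>k w. app f (ncmono w) = app g (ncmono w) \<Longrightarrow> app (f * P k) (ncmono w) = app (g * P k) (ncmono w)"
  shows "f = g"
proof (rule app_eq_monoI)
  show "app f (ncmono w) = app g (ncmono w)" for w
    by (induction w) (use assms in \<open>auto simp: ncmono_Nil ncmono_Cons\<close>)
qed

text \<open>A diagonal \<open>L\<close> with multiplicative eigenvalues scales \<open>P k\<close> by
  \<open>b k\<close>; since \<open>qop j\<close> removes a letter \<open>j\<close>, it is scaled by
  the inverse of \<open>b j\<close>. This treats \<open>Kop\<close> and \<open>Kinvop\<close>
  together.\<close>

lemma diagonal_qop: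
  assumes L: "\<And>w. app L (ncmono w) = ncscale (a w) (ncmono w)" "\<And>k w. a (k # w) = b k * a w"
    and b: "b j \<noteq> 0"
  shows "L * qop j = endscale (inverse (b j)) (qop j * L)"
proof (rule ncend_eq_wordI)
  have "app L 1 = ncscale (a []) 1" using L(1)[of "[]"] by (simp add: ncmono_Nil)
  then show "app (L * qop j) 1 = app (endscale (inverse (b j)) (qop j * L)) 1" by simp
next
  fix k w
  have LP: "L * P k = endscale (b k) (P k * L)"
    by (rule app_eq_monoI) (simp add: L lmult_mono del: app_lmult)
  have Lk: "L * ksq l = Kinvop l * (Kinvop l * L)" for l
    by (rule app_eq_monoI) (simp add: L mult_ac)
  assume IH: "app (L * qop j) (ncmono w) = app (endscale (inverse (b j)) (qop j * L)) (ncmono w)"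
  have "L * qop j * P k = endscale (vc j k) (L * P k * qop j) + (if j = k then endscale (1 - (vi j)\<^sup>2) (L - L * ksq j) else 0)"
    by (simp add: mult.assoc qop_P algebra_simps)
  also have "\<dots> = endscale (vc j k * b k) (P k * (L * qop j)) + (if j = k then endscale (1 - (vi j)\<^sup>2) (L - ksq j * L) else 0)"
    by (simp add: LP Lk mult.assoc)
  finally have 1: "L * qop j * P k = \<dots>" .
  have "qop j * L * P k = endscale (b k) (qop j * P k * L)"
    by (simp add: mult.assoc LP)
  also have "\<dots> = endscale (b k * vc j k) (P k * (qop j * L)) + (if j = k then endscale (b k * (1 - (vi j)\<^sup>2)) (L - ksq j * L) else 0)"
    by (simp add: qop_P algebra_simps)
  finally have 2: "qop j * L * P k = \<dots>" .
  show "app (L * qop j * P k) (ncmono w) = app (endscale (inverse (b j)) (qop j * L) * P k) (ncmono w)"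
    using IH b by (simp add: 1 en.scale_mult_left 2 del: app_lmult)
      (auto simp: nc.scale_right_distrib mult_ac)
qed

lemma Kinvop_qop: "Kinvop i * qop j = endscale (inverse (vc i j)) (qop j * Kinvop i)"
  by (rule diagonal_qop[of _ "wt i" "vc i"]) auto

lemma Kop_qop: "Kop i * qop j = endscale (vc i j) (qop j * Kop i)"
  using diagonal_qop[of "Kop i" "\<lambda>w. inverse (wt i w)" "\<lambda>k. inverse (vc i k)" j] by simp

lemma P_qop: "P i * qop j = endscale (inverse (vc j i)) (qop j * P i)
   - (if i = j then endscale (inverse (vc j i) * (1 - (vi j)\<^sup>2)) (1 - ksq j) else 0)"
  by (simp add: qop_P en.scale_right_distrib)

lemma ksq_P: "ksq i * P j = endscale ((vc i j)\<^sup>2) (P j * ksq i)"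
proof -
  have "Kinvop i * (P j * z) = endscale (vc i j) (P j * (Kinvop i * z))" for z
    by (simp add: mult.assoc[symmetric] Kinvop_P)
  then show ?thesis by (simp add: mult.assoc Kinvop_P power2_eq_square)
qed

lemma ksq_qop: "ksq i * qop j = endscale ((inverse (vc i j))\<^sup>2) (qop j * ksq i)"
proof -
  have "Kinvop i * (qop j * z) = endscale (inverse (vc i j)) (qop j * (Kinvop i * z))" for z
    by (simp add: mult.assoc[symmetric] Kinvop_qop)
  then show ?thesis by (simp add: mult.assoc Kinvop_qop power2_eq_square)
qed

section \<open>The Serre elements as operators on the Verma module\<close>

definition Yop :: "nat \<Rightarrow> nat \<Rightarrow> (nat, ratfun) ncend" where
  "Yop i j = en.qad (vi i) (vc i j) (P i) (P j) (Suc (cm i j))"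

text \<open>Up to a scalar and a right factor in the \<open>Kop\<close>, the Serre element in the
  \<open>E_i\<close> acts by this operator. The inverted parameters are those of the relations
  between \<open>P\<close> and \<open>qop\<close> read in the opposite direction.\<close>

definition Yop' :: "nat \<Rightarrow> nat \<Rightarrow> (nat, ratfun) ncend" where
  "Yop' i j = en.qad (inverse (vi i)) (inverse (vc i j)) (qop i) (qop j) (Suc (cm i j))"

definition scalar_commute :: "(nat, ratfun) ncend \<Rightarrow> (nat, ratfun) ncend \<Rightarrow> bool" where
  "scalar_commute f g \<longleftrightarrow> (\<exists>c. c \<noteq> 0 \<and> f * g = endscale c (g * f))"

lemma scalar_commuteI: "f * g = endscale c (g * f) \<Longrightarrow> c \<noteq> 0 \<Longrightarrow> scalar_commute f g"
  by (auto simp: scalar_commute_def)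

context
  fixes i j assumes ij: "i \<in> {1..N}" "j \<in> {1..N}" "i \<noteq> j"
begin

lemma qad_coeff_zero: "qad_coeff (vi i) (vc i j) (Suc (cm i j)) = 0"
proof -
  have "(vc i j)\<^sup>2 * vi i ^ (2 * cm i j) = (vc i j * vi i ^ cm i j)\<^sup>2"
    by (simp add: power_mult_distrib power_mult[symmetric] mult.commute)
  then show ?thesis using vc_cm[OF ij] by (simp add: qad_coeff_def)
qed

lemma prod_zero_cm: "(\<Prod>k\<le>cm i j. 1 - (vc i j)\<^sup>2 * vi i ^ (2 * k)) = 0"
proof -
  have "(vc i j)\<^sup>2 * vi i ^ (2 * cm i j) = (vc i j * vi i ^ cm i j)\<^sup>2"
    by (simp add: power_mult_distrib power_mult[symmetric] mult.commute)
  then show ?thesis using vc_cm[OF ij] by (intro prod_zero) auto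
qed

lemma vc_cm_inverse: "inverse (vc i j) * inverse (vi i) ^ cm i j = 1"
  using vc_cm[OF ij] by (metis inverse_1 inverse_mult_distrib power_inverse)

lemma qad_coeff_zero': "qad_coeff (inverse (vi i)) (inverse (vc i j)) (Suc (cm i j)) = 0"
proof -
  have "(inverse (vc i j))\<^sup>2 * inverse (vi i) ^ (2 * cm i j) = (inverse (vc i j) * inverse (vi i) ^ cm i j)\<^sup>2"
    by (simp only: power_mult_distrib power_mult[symmetric] mult.commute)
  then show ?thesis using vc_cm_inverse by (simp add: qad_coeff_def)
qed

lemma prod_zero_cm': "(\<Prod>k\<le>cm i j. 1 - (inverse (vc i j))\<^sup>2 * inverse (vi i) ^ (2 * k)) = 0"
proof -
  have "(inverse (vc i j))\<^sup>2 * inverse (vi i) ^ (2 * cm i j) = (inverse (vc i j) * inverse (vi i) ^ cm i j)\<^sup>2"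
    by (simp only: power_mult_distrib power_mult[symmetric] mult.commute)
  then show ?thesis using vc_cm_inverse by (intro prod_zero) auto
qed

lemma rank_two_relations:
  "qop i * P i = endscale ((vi i)\<^sup>2) (P i * qop i) + endscale (1 - (vi i)\<^sup>2) (1 - ksq i)"
  "ksq i * P i = endscale (vi i ^ 4) (P i * ksq i)"
  "ksq i * P j = endscale ((vc i j)\<^sup>2) (P j * ksq i)"
  "qop i * P j = endscale (vc i j) (P j * qop i)"
  using ij by (simp_all add: qop_P ksq_P vc_diag power_mult[symmetric])

lemma rank_two_relations':
  "P i * qop i = endscale ((inverse (vi i))\<^sup>2) (qop i * P i) + endscale (1 - (inverse (vi i))\<^sup>2) (1 - ksq i)"
  "ksq i * qop i = endscale (inverse (vi i) ^ 4) (qop i * ksq i)"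
  "ksq i * qop j = endscale ((inverse (vc i j))\<^sup>2) (qop j * ksq i)"
  "P i * qop j = endscale (inverse (vc i j)) (qop j * P i)"
proof -
  have "1 - (inverse (vi i))\<^sup>2 = - (inverse (vc i i) * (1 - (vi i)\<^sup>2))"
    using ij by (simp add: vc_diag field_simps)
  then have "endscale (1 - (inverse (vi i))\<^sup>2) X = - endscale (inverse (vc i i) * (1 - (vi i)\<^sup>2)) X" for X :: "(nat, ratfun) ncend"
    by (simp only: en.scale_minus_left)
  then show "P i * qop i = endscale ((inverse (vi i))\<^sup>2) (qop i * P i) + endscale (1 - (inverse (vi i))\<^sup>2) (1 - ksq i)"
    unfolding P_qop using ij by (simp add: vc_diag power_inverse)
  show "ksq i * qop i = endscale (inverse (vi i) ^ 4) (qop i * ksq i)"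
    unfolding ksq_qop using ij by (simp add: vc_diag power_mult[symmetric] power_inverse)
  show "ksq i * qop j = endscale ((inverse (vc i j))\<^sup>2) (qop j * ksq i)"
    by (rule ksq_qop)
  show "P i * qop j = endscale (inverse (vc i j)) (qop j * P i)"
    unfolding P_qop using ij by (simp add: vc_sym)
qed

text \<open>The Serre elements are singular: for \<open>k = i\<close> the lowering coefficient in
  degree \<open>m + 1\<close> is zero, for \<open>k = j\<close> the product in the remainder has a
  zero factor, and any other \<open>qop k\<close> commutes up to scalars with both
  \<open>P i\<close> and \<open>P j\<close>.\<close>

lemma qop_Yop: "scalar_commute (qop k) (Yop i j)"
proof -
  consider "k = i" | "k = j" | "k \<noteq> i" "k \<noteq> j" by blast
  then show ?thesis
  proof cases
    case 1
    show ?thesis unfolding 1 Yop_def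
      using en.qad_lower[OF rank_two_relations, of "Suc (cm i j)"]
      by (intro scalar_commuteI) (auto simp: qad_coeff_zero)
  next
    case 2
    have "qop j * P i = endscale (vc i j) (P i * qop j)"
      using ij by (simp add: qop_P vc_sym)
    moreover have "qop j * P j = endscale ((vi j)\<^sup>2) (P j * qop j) + endscale (1 - (vi j)\<^sup>2) (1 - ksq j)"
      using ij by (simp add: qop_P vc_diag)
    moreover have "ksq j * P i = endscale ((vc i j)\<^sup>2) (P i * ksq j)"
      using ij by (simp add: ksq_P vc_sym)
    ultimately show ?thesis unfolding 2 Yop_def
      using en.qad_lower'[of "qop j" "P i" "vc i j" "P j" "(vi j)\<^sup>2" "1 - (vi j)\<^sup>2" "ksq j" "vi i" "cm i j"]
      by (intro scalar_commuteI) (auto simp: prod_zero_cm)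
  next
    case 3
    then show ?thesis unfolding Yop_def
      by (intro scalar_commuteI[OF en.qad_commute[of _ _ "vc k i" _ "vc k j"]]) (auto simp: qop_P)
  qed
qed

lemma P_Yop': "scalar_commute (P k) (Yop' i j)"
proof -
  consider "k = i" | "k = j" | "k \<noteq> i" "k \<noteq> j" by blast
  then show ?thesis
  proof cases
    case 1
    show ?thesis unfolding 1 Yop'_def
      using en.qad_lower[OF rank_two_relations', of "Suc (cm i j)"]
      by (intro scalar_commuteI) (auto simp: qad_coeff_zero')
  next
    case 2
    have "P j * qop i = endscale (inverse (vc i j)) (qop i * P j)"
      using ij by (simp add: P_qop)
    moreover have "P j * qop j = endscale (inverse (vc j j)) (qop j * P j) + endscale (- (inverse (vc j j) * (1 - (vi j)\<^sup>2))) (1 - ksq j)"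
      by (simp add: P_qop)
    moreover have "ksq j * qop i = endscale ((inverse (vc i j))\<^sup>2) (qop i * ksq j)"
      using ij by (simp add: ksq_qop vc_sym)
    ultimately show ?thesis unfolding 2 Yop'_def
      using en.qad_lower'[of "P j" "qop i" "inverse (vc i j)" "qop j" "inverse (vc j j)"
          "- (inverse (vc j j) * (1 - (vi j)\<^sup>2))" "ksq j" "inverse (vi i)" "cm i j"]
      by (intro scalar_commuteI) (auto simp: prod_zero_cm')
  next
    case 3
    then show ?thesis unfolding Yop'_def
      by (intro scalar_commuteI[OF en.qad_commute[of _ _ "inverse (vc i k)" _ "inverse (vc j k)"]]) (auto simp: P_qop)
  qed
qed

lemma K_Yop: "scalar_commute (Kop k) (Yop i j)" "scalar_commute (Kinvop k) (Yop i j)"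
  unfolding Yop_def
  by (rule scalar_commuteI[OF en.qad_commute[OF Kop_P Kop_P]], simp)
     (rule scalar_commuteI[OF en.qad_commute[OF Kinvop_P Kinvop_P]], simp)

text \<open>The operator kills 1, since every \<open>qop\<close> does, and it commutes with each
  \<open>P k\<close> up to a nonzero scalar; hence it kills all words. So the Serre relation for
  \<open>E\<close> holds exactly, not only modulo the Serre relations for \<open>F\<close>.\<close>

lemma Yop'_zero: "Yop' i j = 0"
proof (rule ncend_eq_wordI)
  have "app (en.qad w u (qop i) (qop j) n) 1 = 0" for w u n
    by (induction n) auto
  then show "app (Yop' i j) 1 = app 0 1" by (simp add: Yop'_def)
next
  fix k w assume IH: "app (Yop' i j) (ncmono w) = app 0 (ncmono w)"
  obtain c where "c \<noteq> 0" "P k * Yop' i j = endscale c (Yop' i j * P k)"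
    using P_Yop' by (auto simp: scalar_commute_def)
  then have "Yop' i j * P k = endscale (inverse c) (P k * Yop' i j)"
    by simp
  then have "app (Yop' i j * P k) (ncmono w) = app (endscale (inverse c) (P k * Yop' i j)) (ncmono w)"
    by (simp only:)
  then show "app (Yop' i j * P k) (ncmono w) = app (0 * P k) (ncmono w)"
    using IH by simp
qed

text \<open>The continuant is additive in its last factor. The part at \<open>P j\<close> is the
  commutator itself; the part at \<open>qop j\<close>, read in reverse, is the continuant of
  \<open>Yop'\<close> and vanishes.\<close>

lemma Yop_eq_continuant:
  "Yop i j = en.continuant (\<lambda>n. vc i j * vi i ^ (2 * n)) (qad_coeff (vi i) (vc i j)) (P i + qop i) (P j + qop j) (Suc (cm i j))"
proof -
  let ?c = "\<lambda>z. en.continuant (\<lambda>n. vc i j * vi i ^ (2 * n)) (qad_coeff (vi i) (vc i j)) (P i + qop i) z (Suc (cm i j))"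
  have "?c (P j) = Yop i j"
    unfolding Yop_def by (rule en.continuant_eq_qad[OF rank_two_relations]) simp
  moreover have "?c (qop j) = 0"
  proof -
    have "?c (qop j) = en.continuant (\<lambda>k. vc i j * vi i ^ (2 * (cm i j - k))) (\<lambda>k. qad_coeff (vi i) (vc i j) (Suc (cm i j) - k))
        (P i + qop i) (qop j) (Suc (cm i j))"
      by (subst en.continuant_reverse) simp
    also have "\<dots> = en.continuant (\<lambda>n. inverse (vc i j) * inverse (vi i) ^ (2 * n)) (qad_coeff (inverse (vi i)) (inverse (vc i j)))
        (P i + qop i) (qop j) (Suc (cm i j))"
    proof (rule en.continuant_cong)
      fix k
      \<comment> \<open>Since \<open>a * b = v_i ^ m\<close> is the inverse of
        \<open>vc i j\<close>, reversal of the index inverts the parameters in both coefficient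
        sequences.\<close>
      define a b where "a = vi i ^ k" and "b = vi i ^ (cm i j - k)"
      have ab: "vc i j * b = inverse a" "inverse (vc i j) = a * b" if "k < Suc (cm i j)"
      proof -
        have "vc i j * (a * b) = 1"
          using vc_cm[OF ij] that by (simp add: a_def b_def power_add[symmetric])
        then show "vc i j * b = inverse a" "inverse (vc i j) = a * b"
          by (metis inverse_unique mult.assoc mult.commute)+
      qed
      have a: "a \<noteq> 0" "vi i ^ (2 * k) = a\<^sup>2" "vi i ^ (2 * (cm i j - k)) = b\<^sup>2"
        by (simp_all add: a_def b_def power_mult[symmetric] mult.commute)
      {
        assume "k < Suc (cm i j)"
        then have "vc i j * b * b = inverse a * b" "inverse (vc i j) * (inverse a)\<^sup>2 = a * b * (inverse a)\<^sup>2"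
          by (simp_all only: ab)
        moreover have "a * b * (inverse a)\<^sup>2 = inverse a * b"
          using a(1) by (simp add: power2_eq_square)
        ultimately have "vc i j * b * b = inverse (vc i j) * (inverse a)\<^sup>2"
          by (simp only:)
        then have "vc i j * b\<^sup>2 = inverse (vc i j) * (inverse a)\<^sup>2"
          by (simp add: power2_eq_square mult.assoc)
        then show "vc i j * vi i ^ (2 * (cm i j - k)) = inverse (vc i j) * inverse (vi i) ^ (2 * k)"
          by (simp add: a power_inverse)
      }
      assume k: "0 < k" "k < Suc (cm i j)"
      have "qad_coeff (vi i) (vc i j) (Suc (cm i j) - k) = (1 - (vi i)\<^sup>2 * b\<^sup>2) * (1 - (vc i j * b)\<^sup>2)"
        using k by (simp add: qad_coeff_def Suc_diff_le a power_mult_distrib power2_eq_square[of "vi i"] mult.assoc)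
      moreover have "inverse (vi i) ^ (2 * k - 2) = (vi i)\<^sup>2 * (inverse a)\<^sup>2"
      proof -
        have "inverse (vi i) ^ (2 * k) = inverse (vi i) ^ (2 * k - 2) * (inverse (vi i))\<^sup>2"
          using k by (cases k) (simp_all add: power2_eq_square)
        then have "(vi i)\<^sup>2 * inverse (vi i) ^ (2 * k) = inverse (vi i) ^ (2 * k - 2) * (inverse (vi i) * vi i)\<^sup>2"
          by (simp only: power_mult_distrib mult_ac)
        then show ?thesis by (simp add: a power_inverse)
      qed
      then have "qad_coeff (inverse (vi i)) (inverse (vc i j)) k = (1 - (inverse a)\<^sup>2) * (1 - (vi i)\<^sup>2 * b\<^sup>2)"
        using ab(2)[OF k(2)] a(1) by (simp add: qad_coeff_def a power_inverse power_mult_distrib)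
      ultimately show "qad_coeff (vi i) (vc i j) (Suc (cm i j) - k) = qad_coeff (inverse (vi i)) (inverse (vc i j)) k"
        using ab(1)[OF k(2)] by (simp add: mult.commute)
    qed
    also have "\<dots> = Yop' i j"
      unfolding Yop'_def add.commute[of "P i"] by (rule en.continuant_eq_qad[OF rank_two_relations']) simp
    finally show ?thesis by (simp add: Yop'_zero)
  qed
  ultimately show ?thesis by (simp add: en.continuant_add)
qed

end

end

section \<open>The linear map to the quantum torus\<close>

lemma (in algebra_ideal) qcommute_inverse:
  assumes "X * X' \<approx> 1" "X' * X \<approx> 1" "X * Z \<approx> s *s (Z * X)" "s \<noteq> 0"
  shows "X' * Z \<approx> inverse s *s (Z * X')"
proof -
  have "X' * Z = X' * Z * 1" by simp
  also have "\<dots> \<approx> X' * Z * (X * X')" by (intro eqv_mult_left eqv_sym[OF assms(1)])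
  also have "\<dots> = X' * (Z * X) * X'" by (simp add: mult.assoc)
  also have "\<dots> \<approx> X' * (inverse s *s (X * Z)) * X'"
  proof (intro eqv_mult_left eqv_mult_right)
    have "inverse s *s (X * Z) \<approx> inverse s *s (s *s (Z * X))" by (intro eqv_scale assms)
    then show "Z * X \<approx> inverse s *s (X * Z)" using assms(4) by (simp add: eqv_sym)
  qed
  also have "\<dots> = inverse s *s ((X' * X) * (Z * X'))" by (simp add: mult.assoc)
  also have "\<dots> \<approx> inverse s *s (1 * (Z * X'))" by (intro eqv_scale eqv_mult_right assms)
  finally show ?thesis by simp
qed

context cartan_datum
begin

definition torus_B :: "nat \<Rightarrow> (torus_gen, ratfun) ncpoly" where
  "torus_B i = ngen (Xgen i) + ngen (Xinv i)"

function theta_word :: "nat list \<Rightarrow> (torus_gen, ratfun) ncpoly" where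
  "theta_word [] = 1"
| "theta_word (i # w) = torus_B i * theta_word w - (\<Sum>(c, x)\<leftarrow>lower_terms i w. ncscale c (theta_word x))"
  by pat_completeness auto
termination
  by (relation "measure length") (auto dest: lower_terms_length intro: less_SucI)

definition theta :: "(nat, ratfun) ncpoly \<Rightarrow> (torus_gen, ratfun) ncpoly" where
  "theta = nc.linext theta_word"

lemma theta_simps [simp]:
  "theta (p + q) = theta p + theta q" "theta (p - q) = theta p - theta q"
  "theta (ncscale c p) = ncscale c (theta p)" "theta 0 = 0" "theta (ncmono w) = theta_word w"
  by (simp_all add: theta_def)

lemma theta_1 [simp]: "theta 1 = 1"
  using theta_simps(5)[of "[]"] by (simp add: ncmono_Nil del: theta_simps(5))

lemma theta_P: "theta (ngen i * p) = torus_B i * theta p - theta (app (qop i) p)"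
proof (induction p rule: ncpoly_induct)
  case (mono w)
  have "theta (\<Sum>(c, x)\<leftarrow>l. ncscale c (ncmono x)) = (\<Sum>(c, x)\<leftarrow>l. ncscale c (theta_word x))" for l
    by (induction l) auto
  then show ?case by (simp add: ncmono_Cons[symmetric] qop_def)
next
  case (scale c p)
  then show ?case by (simp add: nc.scale_right_diff_distrib)
qed (simp_all add: algebra_simps)

lemma theta_B: "theta (app (P i + qop i) p) = torus_B i * theta p"
  by (simp add: theta_P)

text \<open>A continuant is a polynomial in \<open>P i + qop i\<close> and
  \<open>P j + qop j\<close>, each of which \<open>theta\<close> turns into a left multiplication.
  The vector \<open>p\<close> must vary in the induction, because right multiplication by an
  operator replaces \<open>p\<close> by its image.\<close>

lemma theta_continuant:
  "theta (app (en.continuant b g (P i + qop i) (P j + qop j) n) p) = nc.continuant b g (torus_B i) (torus_B j) n * theta p"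
proof (induction b g "P i + qop i" "P j + qop j" n arbitrary: p rule: en.continuant.induct)
  case (2 b g)
  show ?case
    using theta_B[of i "app (P j + qop j) p"] theta_B[of j "app (P i + qop i) p"] theta_B[of i p] theta_B[of j p]
    by (simp only: en.continuant.simps nc.continuant.simps app_simps(4,6,7) theta_simps)
       (simp add: algebra_simps)
next
  case (3 b g n)
  show ?case
    using 3 theta_B[of i "app (en.continuant b g (P i + qop i) (P j + qop j) (Suc n)) p"] theta_B[of i p]
    by (simp only: en.continuant.simps(3) nc.continuant.simps(3) app_simps(4,6,7) theta_simps)
       (simp add: algebra_simps)
qed (use theta_B in simp)

text \<open>
  The index counts the left multiplications by letters.  The induction for \<open>\<theta>\<close> needs it: \<open>\<theta>(P\<^sub>k p)\<close> involves
  \<open>\<theta>(q\<^sub>k p)\<close>, and \<open>q\<^sub>k\<close> does not raise the index.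
\<close>

inductive serre_layer :: "nat \<Rightarrow> (nat, ratfun) ncpoly \<Rightarrow> bool" where
  zero: "serre_layer n 0"
| add: "serre_layer n p \<Longrightarrow> serre_layer n q \<Longrightarrow> serre_layer n (p + q)"
| scale: "serre_layer n p \<Longrightarrow> serre_layer n (ncscale c p)"
| base: "i \<in> {1..N} \<Longrightarrow> j \<in> {1..N} \<Longrightarrow> i \<noteq> j \<Longrightarrow> serre_layer n (app (Yop i j) p)"
| step: "serre_layer n p \<Longrightarrow> serre_layer (Suc n) (ngen k * p)"

lemma serre_layer_Suc: "serre_layer n p \<Longrightarrow> serre_layer (Suc n) p"
  by (induction rule: serre_layer.induct) (auto intro: serre_layer.intros)

lemma serre_layer_diff: "serre_layer n p \<Longrightarrow> serre_layer n q \<Longrightarrow> serre_layer n (p - q)"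
  using serre_layer.add[OF _ serre_layer.scale[of n q "- 1"]] by (simp add: nc.scale_minus_left)

lemma serre_layer_scalar_commute:
  assumes "\<And>i j. i \<in> {1..N} \<Longrightarrow> j \<in> {1..N} \<Longrightarrow> i \<noteq> j \<Longrightarrow> scalar_commute f (Yop i j)"
    and "\<And>n k p. serre_layer n p \<Longrightarrow> serre_layer n (app f p) \<Longrightarrow> serre_layer (Suc n) (app (f * P k) p)"
    and "serre_layer n p"
  shows "serre_layer n (app f p)"
  using assms(3)
proof (induction rule: serre_layer.induct)
  case (base i j n p)
  then obtain c where "f * Yop i j = endscale c (Yop i j * f)"
    using assms(1) by (auto simp: scalar_commute_def)
  then have "app f (app (Yop i j) p) = ncscale c (app (Yop i j) (app f p))"
    by (metis app_simps(6,7))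
  then show ?case using base by (simp only:) (intro serre_layer.scale serre_layer.base)
next
  case (step n p k)
  then show ?case using assms(2)[of n p k] by simp
qed (auto intro: serre_layer.intros)

lemma serre_layer_K:
  assumes "serre_layer n p"
  shows "serre_layer n (app (Kop k) p)" "serre_layer n (app (Kinvop k) p)"
  by (rule serre_layer_scalar_commute[OF _ _ assms]; auto simp: K_Yop Kop_P Kinvop_P simp del: app_simps(6)
        intro!: serre_layer.intros; simp add: serre_layer.step)+

text \<open>Moving \<open>qop k\<close> past a letter creates only a multiple of the difference of
  \<open>p\<close> and its image under \<open>ksq k\<close>, which stays in the layer of
  \<open>p\<close>.\<close>

lemma serre_layer_qop:
  assumes "serre_layer n p"
  shows "serre_layer n (app (qop k) p)"
proof (rule serre_layer_scalar_commute[OF _ _ assms])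
  fix n l p assume p: "serre_layer n p" "serre_layer n (app (qop k) p)"
  have "serre_layer (Suc n) (p - app (Kinvop k) (app (Kinvop k) p))"
    using p(1) by (intro serre_layer_diff serre_layer_Suc serre_layer_K)
  then show "serre_layer (Suc n) (app (qop k * P l) p)"
    unfolding qop_P using p by (auto intro!: serre_layer.intros)
qed (rule qop_Yop)

text \<open>The union of the layers is the two-sided ideal of the free algebra generated by the
  Serre elements in the letters.\<close>

definition in_serre :: "(nat, ratfun) ncpoly \<Rightarrow> bool" where
  "in_serre p \<longleftrightarrow> (\<exists>n. serre_layer n p)"

lemma serre_layer_mono: "serre_layer n p \<Longrightarrow> serre_layer (n + k) p"
  by (induction k) (auto intro: serre_layer_Suc)

lemma in_serre_add: "in_serre p \<Longrightarrow> in_serre q \<Longrightarrow> in_serre (p + q)"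
  unfolding in_serre_def by (metis serre_layer_mono serre_layer.add add.commute)

section \<open>The action of the quantum group up to Serre relations\<close>

definition rho_gen :: "dj_gen \<Rightarrow> (nat, ratfun) ncend" where
  "rho_gen g = (case g of Egen i \<Rightarrow> endscale (inverse (varsigma d i)) (qop i * Kop i)
     | Fgen i \<Rightarrow> P i | Kgen i \<Rightarrow> Kop i | Kinv i \<Rightarrow> Kinvop i)"

definition rho :: "(dj_gen, ratfun) ncpoly \<Rightarrow> (nat, ratfun) ncend" where
  "rho = en.alghom rho_gen"

lemma in_serre_rho_gen: "in_serre p \<Longrightarrow> in_serre (app (rho_gen g) p)"
  by (cases g) (auto simp: in_serre_def rho_gen_def intro: serre_layer_K serre_layer_qop serre_layer.intros)

lemma in_serre_rho: "in_serre p \<Longrightarrow> in_serre (app (rho u) p)"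
proof (induction u rule: ncpoly_induct)
  case (mono w)
  have "in_serre (app (prod_list (map rho_gen v)) p)" for v
    by (induction v) (use mono in \<open>auto intro: in_serre_rho_gen\<close>)
  then show ?case by (simp add: rho_def en.alghom_mono)
next
  case (add u v)
  then show ?case by (simp add: rho_def in_serre_add)
qed (auto simp: rho_def in_serre_add in_serre_def intro: serre_layer.intros)

lemma rho_simps [simp]:
  "rho (p + q) = rho p + rho q" "rho (p - q) = rho p - rho q" "rho (p * q) = rho p * rho q"
  "rho 1 = 1" "rho 0 = 0" "rho (ngen g) = rho_gen g" "rho (nconst c) = endscale c 1" "rho (p ^ n) = rho p ^ n"
  "rho (ncscale c p) = endscale c (rho p)" "rho (- p) = - rho p"
  by (simp_all add: rho_def)

lemma vi_diff_nonzero: "i \<in> {1..N} \<Longrightarrow> vi i - inverse (vi i) \<noteq> 0"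
  using vi_power_neq_1[of i 2] by (auto simp: power2_eq_square field_simps)

lemma varsigma_nonzero: "i \<in> {1..N} \<Longrightarrow> varsigma d i \<noteq> 0"
  using vi_diff_nonzero[of i] by (simp add: varsigma_def Let_def vi_def[symmetric])

text \<open>Here the distinguished value of the parameter enters: it normalises the commutator of
  \<open>E_i\<close> and \<open>F_i\<close>.\<close>

lemma varsigma_scalar:
  assumes i: "i \<in> {1..N}"
  shows "inverse (varsigma d i) * (inverse ((vi i)\<^sup>2) * (1 - (vi i)\<^sup>2)) = 1 / (vi i - inverse (vi i))"
proof -
  define \<delta> where "\<delta> = vi i - inverse (vi i)"
  have "inverse ((vi i)\<^sup>2) * (1 - (vi i)\<^sup>2) = - inverse (vi i) * \<delta>"
    by (simp add: \<delta>_def power2_eq_square field_simps)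
  moreover have "varsigma d i = - inverse (vi i) * \<delta>\<^sup>2"
    by (simp add: varsigma_def Let_def vi_def[symmetric] \<delta>_def)
  moreover have "inverse (- inverse (vi i) * \<delta>\<^sup>2) * (- inverse (vi i) * \<delta>) = 1 / \<delta>"
    using vi_diff_nonzero[OF i] by (simp add: \<delta>_def[symmetric] power2_eq_square field_simps)
  ultimately show ?thesis
    unfolding \<delta>_def[symmetric] by (simp only:)
qed

lemma rho_EF:
  assumes ij: "i \<in> {1..N}" "j \<in> {1..N}"
  shows "rho (ngen (Egen i) * ngen (Fgen j) - ngen (Fgen j) * ngen (Egen i)
    - (if i = j then nconst (1 / (qv ^ d i - inverse (qv ^ d i))) * (ngen (Kgen i) - ngen (Kinv i)) else 0)) = 0"
proof -
  have 1: "qop i * (Kop i * P j) = endscale (inverse (vc i j)) (qop i * P j * Kop i)"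
    by (simp add: Kop_P mult.assoc)
  show ?thesis
  proof (cases "i = j")
    case True
    have "qop i * (Kop i * P i) = P i * (qop i * Kop i) + endscale (inverse ((vi i)\<^sup>2) * (1 - (vi i)\<^sup>2)) (Kop i - Kinvop i)"
      using ij True 1 by (simp add: qop_P vc_diag mult.assoc distrib_right left_diff_distrib en.scale_right_distrib)
    then have "endscale (inverse (varsigma d i)) (qop i * (Kop i * P i)) = endscale (inverse (varsigma d i)) (P i * (qop i * Kop i))
        + endscale (1 / (vi i - inverse (vi i))) (Kop i - Kinvop i)"
      by (simp add: en.scale_right_distrib varsigma_scalar[OF ij(1), symmetric] del: en.scale_right_diff_distrib)
    then show ?thesis using True
      by (simp add: rho_gen_def mult.assoc vi_def[symmetric])
  next
    case False
    then have "qop i * (Kop i * P j) = P j * (qop i * Kop i)"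
      using 1 by (simp add: qop_P mult.assoc)
    then show ?thesis using False by (simp add: rho_gen_def mult.assoc)
  qed
qed

lemma rho_KE: "rho (ngen (Kgen i) * ngen (Egen j) - nconst ((qv ^ d i) powi C i j) * ngen (Egen j) * ngen (Kgen i)) = 0"
proof -
  have "Kop i * (qop j * Kop j) = endscale (vc i j) (qop j * (Kop i * Kop j))"
    by (simp add: mult.assoc[symmetric] Kop_qop)
  then show ?thesis
    by (simp add: rho_gen_def vi_def[symmetric] vc_def[symmetric] mult.assoc K_commute[of i j] mult.commute)
qed

lemma rho_KF: "rho (ngen (Kgen i) * ngen (Fgen j) - nconst ((qv ^ d i) powi (- C i j)) * ngen (Fgen j) * ngen (Kgen i)) = 0"
  by (simp add: rho_gen_def vi_def[symmetric] power_int_minus vc_def[symmetric] Kop_P)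

lemma rho_serre:
  assumes ij: "i \<in> {1..N}" "j \<in> {1..N}" "i \<noteq> j"
  defines "M \<equiv> Suc (cm i j)"
  shows "rho (serre_element C d X i j) = (\<Sum>n=0..M. endscale ((- 1) ^ n * inverse (qfact (vi i) n) * inverse (qfact (vi i) (M - n)))
     (rho (X i) ^ n * rho (X j) * rho (X i) ^ (M - n)))"
proof -
  have "C i j \<le> 0"
    using gcm ij by (simp add: generalized_cartan_matrix_def)
  then have M: "nat (1 - C i j) = M"
    by (simp add: M_def cm_def)
  have sign: "(- 1) ^ n * f = endscale ((- 1) ^ n) f" for n and f :: "(nat, ratfun) ncend"
    by (cases "even n") simp_all
  have "rho (sum f A) = (\<Sum>i\<in>A. rho (f i))" for f and A :: "nat set"
    by (simp add: rho_def en.alghom_sum)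
  then show ?thesis
    by (simp add: serre_element_def Let_def M divided_power_def vi_def[symmetric] mult.assoc sign mult.commute mult.left_commute del: power_Suc)
qed

text \<open>The first form serves the \<open>F_i\<close> and leads to \<open>Yop\<close>, the second
  serves the \<open>E_i\<close> and leads to \<open>Yop'\<close>.\<close>

lemma rho_serre_qad:
  assumes ij: "i \<in> {1..N}" "j \<in> {1..N}" "i \<noteq> j"
  shows "\<exists>c. rho (serre_element C d X i j) = endscale c (en.qad (vi i) (vc i j) (rho (X i)) (rho (X j)) (Suc (cm i j)))"
    "\<exists>c. rho (serre_element C d X i j) = endscale c (en.qad (inverse (vi i)) (inverse (vc i j)) (rho (X i)) (rho (X j)) (Suc (cm i j)))"
proof -
  let ?M = "Suc (cm i j)"
  have v: "vi i ^ (2 * n) \<noteq> 1" "inverse (vi i) ^ (2 * n) \<noteq> 1" if "n > 0" for n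
    using vi_power_neq_1[OF ij(1), of "2 * n"] that by (simp_all add: power_inverse)
  have nz: "(- 1) ^ ?M * qfact (vi i) ?M \<noteq> 0"
    using qfact_nonzero[of "vi i"] v by simp
  have "en.qad (vi i) (vc i j) (rho (X i)) (rho (X j)) ?M = endscale ((- 1) ^ ?M * qfact (vi i) ?M) (rho (serre_element C d X i j))"
    unfolding rho_serre[OF ij]
    by (rule qad_eq_serre[OF en.bilinear_algebra_axioms]) (use v vc_cm[OF ij] in simp_all)
  then have "rho (serre_element C d X i j) = endscale (inverse ((- 1) ^ ?M * qfact (vi i) ?M)) (en.qad (vi i) (vc i j) (rho (X i)) (rho (X j)) ?M)"
    using nz by (simp only: en.scale_scale left_inverse en.scale_one not_False_eq_True)
  then show "\<exists>c. rho (serre_element C d X i j) = endscale c (en.qad (vi i) (vc i j) (rho (X i)) (rho (X j)) ?M)" by blast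
  have "en.qad (inverse (vi i)) (inverse (vc i j)) (rho (X i)) (rho (X j)) ?M = endscale ((- 1) ^ ?M * qfact (inverse (vi i)) ?M) (rho (serre_element C d X i j))"
    unfolding rho_serre[OF ij] qfact_inverse[of "vi i", symmetric]
    by (rule qad_eq_serre[OF en.bilinear_algebra_axioms]) (use v vc_cm_inverse[OF ij] in simp_all)
  then have "rho (serre_element C d X i j) = endscale (inverse ((- 1) ^ ?M * qfact (vi i) ?M)) (en.qad (inverse (vi i)) (inverse (vc i j)) (rho (X i)) (rho (X j)) ?M)"
    using nz by (simp only: en.scale_scale left_inverse en.scale_one not_False_eq_True qfact_inverse)
  then show "\<exists>c. rho (serre_element C d X i j) = endscale c (en.qad (inverse (vi i)) (inverse (vc i j)) (rho (X i)) (rho (X j)) ?M)" by blast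
qed

text \<open>All factors \<open>Kop\<close> are collected on the right. Both products in the
  commutator pick up the same scalar \<open>?t\<close>, by symmetry of \<open>vc\<close>, so the
  commutator with the same coefficient survives.\<close>

lemma qad_E:
  assumes ij: "i \<in> {1..N}" "j \<in> {1..N}"
  shows "\<exists>c. en.qad (inverse (vi i)) (inverse (vc i j)) (rho_gen (Egen i)) (rho_gen (Egen j)) n
    = endscale c (en.qad (inverse (vi i)) (inverse (vc i j)) (qop i) (qop j) n * (Kop i ^ n * Kop j))"
proof (induction n)
  case 0
  then show ?case by (auto simp: rho_gen_def)
next
  case (Suc n)
  let ?Y = "en.qad (inverse (vi i)) (inverse (vc i j)) (qop i) (qop j) n" and ?K = "Kop i ^ n * Kop j"
  let ?b = "inverse (vc i j) * inverse (vi i) ^ (2 * n)" and ?s = "inverse (varsigma d i)" and ?t = "vc i i ^ n * vc i j"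
  obtain c where c: "en.qad (inverse (vi i)) (inverse (vc i j)) (rho_gen (Egen i)) (rho_gen (Egen j)) n = endscale c (?Y * ?K)"
    using Suc by blast
  have KY: "Kop i * ?Y = endscale ?t (?Y * Kop i)"
    by (rule en.qad_commute[OF Kop_qop Kop_qop])
  have Kn: "Kop i ^ k * qop i = endscale (vc i i ^ k) (qop i * Kop i ^ k)" for k
  proof (induction k)
    case (Suc k)
    have "Kop i ^ Suc k * qop i = Kop i * (Kop i ^ k * qop i)" by (simp add: mult.assoc)
    also have "\<dots> = endscale (vc i i ^ k) (Kop i * qop i * Kop i ^ k)" unfolding Suc by (simp add: mult.assoc)
    finally show ?case by (simp add: Kop_qop mult.assoc mult.commute)
  qed simp
  have KQ: "?K * qop i = endscale ?t (qop i * ?K)"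
  proof -
    have "?K * qop i = endscale (vc j i) (Kop i ^ n * qop i * Kop j)" by (simp add: mult.assoc Kop_qop)
    then show ?thesis using ij by (simp add: Kn mult.assoc vc_sym mult.commute)
  qed
  have KK: "?K * Kop i = Kop i ^ Suc n * Kop j" "Kop i * ?K = Kop i ^ Suc n * Kop j"
    by (simp_all add: mult.assoc K_commute[of j i] power_commutes[symmetric])
       (simp add: mult.assoc[symmetric] power_commutes)
  have "rho_gen (Egen i) * (?Y * ?K) = endscale ?s (qop i * (Kop i * ?Y) * ?K)"
    by (simp add: rho_gen_def mult.assoc)
  also have "\<dots> = endscale (?s * ?t) (qop i * ?Y * (Kop i * ?K))"
    unfolding KY by (simp add: mult.assoc)
  finally have 1: "rho_gen (Egen i) * (?Y * ?K) = endscale (?s * ?t) (qop i * ?Y * (Kop i ^ Suc n * Kop j))"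
    unfolding KK .
  have "(?Y * ?K) * rho_gen (Egen i) = endscale ?s (?Y * (?K * qop i) * Kop i)"
    by (simp add: rho_gen_def mult.assoc)
  also have "\<dots> = endscale (?s * ?t) (?Y * qop i * (?K * Kop i))"
    unfolding KQ by (simp add: mult.assoc)
  finally have 2: "(?Y * ?K) * rho_gen (Egen i) = endscale (?s * ?t) (?Y * qop i * (Kop i ^ Suc n * Kop j))"
    unfolding KK .
  have "en.qad (inverse (vi i)) (inverse (vc i j)) (rho_gen (Egen i)) (rho_gen (Egen j)) (Suc n)
     = endscale c (rho_gen (Egen i) * (?Y * ?K)) - endscale (?b * c) ((?Y * ?K) * rho_gen (Egen i))"
    unfolding en.qad.simps c by simp
  also have "\<dots> = endscale (c * (?s * ?t)) ((qop i * ?Y - endscale ?b (?Y * qop i)) * (Kop i ^ Suc n * Kop j))"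
    unfolding 1 2 left_diff_distrib en.scale_right_diff_distrib en.scale_scale en.scale_mult_left
    by (simp only: mult_ac)
  finally show ?case unfolding en.qad.simps by blast
qed

text \<open>All relations act by zero except the Serre relations for \<open>F\<close>, whose images
  are multiples of \<open>Yop\<close>.\<close>

lemma rho_rels:
  assumes "r \<in> dj_rels N C d"
  shows "in_serre (app (rho r) p)"
proof -
  have zero: "in_serre (app (rho r) p)" if "rho r = 0"
    unfolding that in_serre_def by (auto intro: serre_layer.intros)
  from assms consider
      i where "i \<in> {1..N}" "r = ngen (Kgen i) * ngen (Kinv i) - 1"
    | i where "i \<in> {1..N}" "r = ngen (Kinv i) * ngen (Kgen i) - 1"
    | i j where "r = ngen (Kgen i) * ngen (Kgen j) - ngen (Kgen j) * ngen (Kgen i)"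
    | i j where "i \<in> {1..N}" "j \<in> {1..N}" "r = ngen (Egen i) * ngen (Fgen j) - ngen (Fgen j) * ngen (Egen i)
       - (if i = j then nconst (1 / (qv ^ d i - inverse (qv ^ d i))) * (ngen (Kgen i) - ngen (Kinv i)) else 0)"
    | i j where "r = ngen (Kgen i) * ngen (Egen j) - nconst ((qv ^ d i) powi C i j) * ngen (Egen j) * ngen (Kgen i)"
    | i j where "r = ngen (Kgen i) * ngen (Fgen j) - nconst ((qv ^ d i) powi (- C i j)) * ngen (Fgen j) * ngen (Kgen i)"
    | i j where "i \<in> {1..N}" "j \<in> {1..N}" "i \<noteq> j" "r = serre_element C d (\<lambda>i. ngen (Egen i)) i j"
    | i j where "i \<in> {1..N}" "j \<in> {1..N}" "i \<noteq> j" "r = serre_element C d (\<lambda>i. ngen (Fgen i)) i j"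
    unfolding dj_rels_def Let_def by blast
  then show ?thesis
  proof cases
    case (7 i j)
    obtain c where c: "rho r = endscale c (en.qad (inverse (vi i)) (inverse (vc i j)) (rho_gen (Egen i)) (rho_gen (Egen j)) (Suc (cm i j)))"
      using rho_serre_qad(2)[OF 7(1,2,3), of "\<lambda>i. ngen (Egen i)"] unfolding 7(4) rho_simps(6) by blast
    obtain c' where "en.qad (inverse (vi i)) (inverse (vc i j)) (rho_gen (Egen i)) (rho_gen (Egen j)) (Suc (cm i j))
        = endscale c' (Yop' i j * (Kop i ^ Suc (cm i j) * Kop j))"
      using qad_E[OF 7(1,2), of "Suc (cm i j)"] unfolding Yop'_def by blast
    with c show ?thesis
      unfolding Yop'_zero[OF 7(1,2,3)] by (intro zero) (simp del: en.qad.simps)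
  next
    case (8 i j)
    obtain c where "rho r = endscale c (Yop i j)"
      using rho_serre_qad(1)[OF 8(1,2,3), of "\<lambda>i. ngen (Fgen i)"] 8(4) by (auto simp: Yop_def rho_gen_def)
    then have "app (rho r) p = ncscale c (app (Yop i j) p)" by simp
    then show ?thesis
      unfolding in_serre_def using serre_layer.scale[OF serre_layer.base[OF 8(1,2,3)]] by metis
  next
    case (4 i j)
    show ?thesis unfolding 4(3) by (rule zero[unfolded 4(3)]) (rule rho_EF[OF 4(1,2)])
  next
    case (5 i j)
    show ?thesis unfolding 5 by (rule zero[unfolded 5]) (rule rho_KE)
  next
    case (6 i j)
    show ?thesis unfolding 6 by (rule zero[unfolded 6]) (rule rho_KF)
  qed (rule zero; simp add: rho_gen_def K_commute)+
qed

lemma in_serre_two_sided: "u \<in> two_sided (dj_rels N C d) \<Longrightarrow> in_serre (app (rho u) p)"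
proof (induction arbitrary: p rule: two_sided.induct)
  case zero
  then show ?case by (auto simp: in_serre_def intro: serre_layer.intros)
next
  case (base r a b)
  then show ?case using in_serre_rho[OF rho_rels] by (simp add: mult.assoc)
qed (simp add: in_serre_add)

definition dj_B :: "nat \<Rightarrow> (dj_gen, ratfun) ncpoly" where
  "dj_B i = ngen (Fgen i) + ncscale (varsigma d i) (ngen (Egen i) * ngen (Kinv i))"

lemma rho_dj_B: "i \<in> {1..N} \<Longrightarrow> rho (dj_B i) = P i + qop i"
  using varsigma_nonzero[of i] by (simp add: dj_B_def rho_gen_def mult.assoc)

text \<open>A product of the \<open>dj_B i\<close> acts on 1 by the operators
  \<open>P i + qop i\<close>, and \<open>theta\<close> converts these one by one into factors
  \<open>torus_B i\<close>, starting from \<open>theta 1 = 1\<close>.\<close>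

lemma theta_rho:
  assumes "p \<in> fcarrier {1..N}"
  shows "theta (app (rho (nc.alghom dj_B p)) 1) = nc.alghom torus_B p"
proof -
  have word: "theta (app (rho (prod_list (map dj_B w))) 1) = prod_list (map torus_B w)" if "set w \<subseteq> {1..N}" for w
    using that by (induction w) (auto simp: rho_dj_B theta_P)
  have "theta (app (rho (\<Sum>w\<in>A. ncscale (c w) (prod_list (map dj_B (letters w))))) 1)
      = (\<Sum>w\<in>A. ncscale (c w) (prod_list (map torus_B (letters w))))"
    if "\<And>w. w \<in> A \<Longrightarrow> set (letters w) \<subseteq> {1..N}" for A and c :: "nat free_word \<Rightarrow> ratfun"
    using that by (induction A rule: infinite_finite_induct) (simp_all add: word)
  then show ?thesis
    using assms unfolding nc.alghom_def nc.linext_def fcarrier_iff by blast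
qed

end

section \<open>Vanishing on the Serre relations\<close>

locale cartan_quiver = cartan_datum +
  fixes Q :: "'e valued_quiver"
  assumes quiv: "valued_quiver_of N C d Q"
begin

lemma euler_form_unit: "i \<in> {1..N} \<Longrightarrow> j \<in> {1..N} \<Longrightarrow> euler_form Q (unit_vec i) (unit_vec j) = euler_entry Q i j"
proof -
  assume ij: "i \<in> {1..N}" "j \<in> {1..N}"
  have "verts (quiver Q) = {1..N}" using quiv by (simp add: valued_quiver_of_def Let_def)
  moreover have "unit_vec i a * unit_vec j b * x = (if b = j then (if a = i then x else 0) else 0)" for a b x
    by (simp add: unit_vec_def)
  ultimately show ?thesis
    using ij by (simp add: euler_form_def)
qed

lemma arrow_number_sum:
  assumes "i \<in> {1..N}" "j \<in> {1..N}" "i \<noteq> j"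
  shows "int (arrow_number Q i j + arrow_number Q j i) = edge_number C d i j"
proof -
  let ?D = "quiver Q" and ?A = "\<lambda>i j. {a \<in> arcs (quiver Q). tail (quiver Q) a = i \<and> head (quiver Q) a = j}"
  have "finite (arcs ?D)"
    using quiv by (simp add: valued_quiver_of_def Let_def fin_digraph.finite_arcs)
  then have "card (?A i j \<union> ?A j i) = card (?A i j) + card (?A j i)"
    using assms by (intro card_Un_disjoint) auto
  moreover have "?A i j \<union> ?A j i = {a \<in> arcs ?D. {tail ?D a, head ?D a} = {i, j}}"
    by (auto simp: doubleton_eq_iff)
  moreover have "int (card {a \<in> arcs ?D. {tail ?D a, head ?D a} = {i, j}}) = edge_number C d i j"
    using quiv assms unfolding valued_quiver_of_def Let_def by blast
  ultimately show ?thesis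
    by (simp add: arrow_number_def)
qed

text \<open>Write the least common multiple of \<open>d i\<close> and \<open>d j\<close> as
  \<open>d i * l\<close>. Then \<open>r\<close> and \<open>t\<close> are \<open>l\<close> times the
  numbers of arrows from \<open>i\<close> to \<open>j\<close> and from \<open>j\<close> to
  \<open>i\<close>; they add up to \<open>- C i j\<close>, and \<open>s\<close> is the
  \<open>r - t\<close>-th power of \<open>v_i\<close>.\<close>

lemma torus_exponent:
  assumes ij: "i \<in> {1..N}" "j \<in> {1..N}" "i \<noteq> j"
  defines "s \<equiv> qv powi (euler_form Q (unit_vec j) (unit_vec i) - euler_form Q (unit_vec i) (unit_vec j))"
  obtains r t where "r + t = cm i j" "s = vc i j * vi i ^ (2 * r)" "inverse s = vc i j * vi i ^ (2 * t)"
proof -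
  have val: "vertex_value Q k = d k" if "k \<in> {1..N}" for k
    using quiv that by (simp add: valued_quiver_of_def Let_def)
  have neg: "C i j \<le> 0" and d: "d i > 0" and symC: "int (d i) * C i j = int (d j) * C j i"
    using gcm sym ij by (simp_all add: generalized_cartan_matrix_def is_symmetrizer_def)
  define L where "L = lcm (d i) (d j)"
  obtain l where l: "L = d i * l" unfolding L_def by (meson dvd_lcm1 dvdE)
  have Cc: "C i j = - int (cm i j)" using neg by (simp add: cm_def)
  \<comment> \<open>Symmetry of \<open>d i * C i j\<close> makes the division in
    \<open>edge_number\<close> exact.\<close>
  have "int (d i) dvd int (d i) * C i j" "int (d j) dvd int (d i) * C i j"
    unfolding symC[symmetric] by (simp, simp add: symC)
  then have "lcm (int (d i)) (int (d j)) dvd int (d i) * C i j"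
    by (rule lcm_least)
  then have "int L dvd - (int (d i) * C i j)"
    by (simp add: L_def)
  then have "edge_number C d i j * int L = int (d i) * int (cm i j)"
    unfolding edge_number_def L_def[symmetric] using Cc by simp
  then have "int (d i) * (int (arrow_number Q i j + arrow_number Q j i) * int l) = int (d i) * int (cm i j)"
    unfolding arrow_number_sum[OF ij] by (simp add: l mult_ac)
  then have "int (arrow_number Q i j + arrow_number Q j i) * int l = int (cm i j)"
    using d by simp
  then have sum: "arrow_number Q i j * l + arrow_number Q j i * l = cm i j"
    by (metis of_nat_eq_iff of_nat_mult add_mult_distrib)
  define r t where "r = arrow_number Q i j * l" and "t = arrow_number Q j i * l"
  have "euler_form Q (unit_vec j) (unit_vec i) - euler_form Q (unit_vec i) (unit_vec j) = int (d i) * (int r - int t)"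
    using ij l unfolding L_def
    by (simp add: euler_form_unit euler_entry_def val lcm.commute[of "d j"] r_def t_def algebra_simps)
  then have s: "s = vi i powi (int r - int t)"
    by (simp add: s_def vi_def power_int_mult)
  have rt: "vc i j = vi i powi (- int r - int t)"
  proof -
    have "int r + int t = int (cm i j)"
      using sum by (simp add: r_def t_def of_nat_add[symmetric] del: of_nat_add of_nat_mult)
    then have "C i j = - int r - int t" using Cc by simp
    then show ?thesis by (simp only: vc_def)
  qed
  show ?thesis
  proof (rule that)
    show "r + t = cm i j" using sum by (simp add: r_def t_def)
    have "vc i j * vi i ^ (2 * k) = vi i powi (- int r - int t + int (2 * k))" for k
      unfolding rt by (subst power_int_add) (simp_all only: vi_nonzero power_int_of_nat simp_thms)
    from this[of r] this[of t] show "s = vc i j * vi i ^ (2 * r)" "inverse s = vc i j * vi i ^ (2 * t)"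
      by (simp_all add: s power_int_minus[symmetric])
  qed
qed

sublocale T: algebra_ideal ncscale "two_sided (torus_rels N Q)"
  by (rule two_sided_algebra_ideal)

lemma torus_inverse:
  assumes "i \<in> {1..N}"
  shows "T.eqv (ngen (Xgen i) * ngen (Xinv i)) 1" "T.eqv (ngen (Xinv i) * ngen (Xgen i)) 1"
  unfolding T.eqv_def by (rule two_sided_rel; use assms in \<open>auto simp: torus_rels_def\<close>)+

lemma torus_commute:
  assumes "i \<in> {1..N}" "j \<in> {1..N}"
  shows "T.eqv (ngen (Xgen i) * ngen (Xgen j))
    (ncscale (qv powi (euler_form Q (unit_vec j) (unit_vec i) - euler_form Q (unit_vec i) (unit_vec j))) (ngen (Xgen j) * ngen (Xgen i)))"
  unfolding T.eqv_def ncscale_def mult.assoc[symmetric]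
  by (rule two_sided_rel) (use assms in \<open>auto simp: torus_rels_def\<close>)

text \<open>The two summands of \<open>torus_B j\<close> are treated separately. Passing from
  \<open>x_j\<close> to its inverse replaces \<open>s\<close> by its inverse and exchanges
  \<open>r\<close> and \<open>t\<close>; the degree \<open>r + t + 1\<close> is the same.\<close>

lemma torus_continuant:
  assumes ij: "i \<in> {1..N}" "j \<in> {1..N}" "i \<noteq> j"
  shows "nc.continuant (\<lambda>n. vc i j * vi i ^ (2 * n)) (qad_coeff (vi i) (vc i j)) (torus_B i) (torus_B j) (Suc (cm i j))
    \<in> two_sided (torus_rels N Q)"
proof -
  define s where "s = qv powi (euler_form Q (unit_vec j) (unit_vec i) - euler_form Q (unit_vec i) (unit_vec j))"
  obtain r t where rt: "r + t = cm i j" "s = vc i j * vi i ^ (2 * r)" "inverse s = vc i j * vi i ^ (2 * t)"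
    using torus_exponent[OF ij] unfolding s_def by blast
  have s0: "s \<noteq> 0" by (simp add: rt(2))
  let ?X = "ngen (Xgen i) :: (torus_gen, ratfun) ncpoly" and ?X' = "ngen (Xinv i) :: (torus_gen, ratfun) ncpoly"
  let ?Z = "ngen (Xgen j) :: (torus_gen, ratfun) ncpoly" and ?Z' = "ngen (Xinv j) :: (torus_gen, ratfun) ncpoly"
  note inv_i = torus_inverse[OF ij(1)] and inv_j = torus_inverse[OF ij(2)]
  have w: "vi i ^ (2 * n) \<noteq> 1" if "n > 0" for n
    using vi_power_neq_1[OF ij(1), of "2 * n"] that by simp
  have XZ: "T.eqv (?X * ?Z) (ncscale s (?Z * ?X))"
    unfolding s_def by (rule torus_commute[OF ij(1,2)])
  have X'Z: "T.eqv (?X' * ?Z) (ncscale (inverse s) (?Z * ?X'))"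
    by (rule T.qcommute_inverse[OF inv_i XZ s0])
  have scale_swap: "T.eqv b (ncscale (inverse c) a)" if "T.eqv a (ncscale c b)" "c \<noteq> 0" for a b c
    using T.eqv_sym[OF T.eqv_scale[OF that(1), of "inverse c"]] that(2) by simp
  have Z'X: "T.eqv (?Z' * ?X) (ncscale (inverse (inverse s)) (?X * ?Z'))"
    by (rule T.qcommute_inverse[OF inv_j scale_swap[OF XZ s0]]) (simp add: s0)
  have XZ': "T.eqv (?X * ?Z') (ncscale (inverse s) (?Z' * ?X))"
    using scale_swap[OF Z'X] s0 by simp
  have X'Z': "T.eqv (?X' * ?Z') (ncscale (inverse (inverse s)) (?Z' * ?X'))"
    by (rule T.qcommute_inverse[OF inv_i XZ']) (simp add: s0)
  have "nc.continuant (\<lambda>n. vc i j * vi i ^ (2 * n)) (qad_coeff (vi i) (vc i j)) (?X + ?X') ?Z (Suc (r + t)) \<in> two_sided (torus_rels N Q)"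
    by (rule T.qtorus_continuant_mem[OF inv_i XZ X'Z w rt(2,3) s0]) simp_all
  moreover have "nc.continuant (\<lambda>n. vc i j * vi i ^ (2 * n)) (qad_coeff (vi i) (vc i j)) (?X + ?X') ?Z' (Suc (t + r)) \<in> two_sided (torus_rels N Q)"
    by (rule T.qtorus_continuant_mem[OF inv_i XZ' X'Z' w rt(3)]) (use rt(2) s0 in simp_all)
  ultimately show ?thesis
    unfolding torus_B_def nc.continuant_add using rt(1) by (intro T.add_mem) (simp_all add: add.commute)
qed

lemma theta_serre: "serre_layer n p \<Longrightarrow> theta p \<in> two_sided (torus_rels N Q)"
proof (induction n arbitrary: p rule: less_induct)
  case (less n)
  \<comment> \<open>The outer hypothesis is fed into the rule induction, where the index
    \<open>n\<close> is generalised.\<close>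
  from less.prems less.IH show ?case
  proof (induction rule: serre_layer.induct)
    case (base i j n p)
    then have ij: "i \<in> {1..N}" "j \<in> {1..N}" "i \<noteq> j" by auto
    show ?case
      unfolding Yop_eq_continuant[OF ij] theta_continuant
      by (rule T.mult_right_mem[OF torus_continuant[OF ij]])
  next
    case (step n p k)
    \<comment> \<open>Both \<open>p\<close> and its image under \<open>qop k\<close> lie in a
      strictly smaller layer, so the outer hypothesis applies to each.\<close>
    have "theta p \<in> two_sided (torus_rels N Q)" "theta (app (qop k) p) \<in> two_sided (torus_rels N Q)"
      using step.prems[of n] step.hyps serre_layer_qop by auto
    then show ?case
      unfolding theta_P by (intro T.diff_mem T.mult_left_mem)
  qed (auto intro: T.zero_mem T.add_mem T.scale_mem)
qed

lemma torus_relation: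
  assumes "p \<in> fcarrier {1..N}" "nc.alghom dj_B p \<in> two_sided (dj_rels N C d)"
  shows "nc.alghom torus_B p \<in> two_sided (torus_rels N Q)"
proof -
  obtain n where "serre_layer n (app (rho (nc.alghom dj_B p)) 1)"
    using in_serre_two_sided[OF assms(2), of 1] by (auto simp: in_serre_def)
  from theta_serre[OF this] show ?thesis
    by (simp only: theta_rho[OF assms(1)])
qed

end

section \<open>Well-formed presentations and the homomorphism\<close>

lemma serre_element_fcarrier:
  assumes "\<And>k. k \<in> {i, j} \<Longrightarrow> X k \<in> fcarrier G"
  shows "serre_element C d X i j \<in> fcarrier G"
  unfolding serre_element_def divided_power_def Let_def
  by (intro fcarrier_sum fcarrier_mult fcarrier_power fcarrier_uminus fcarrier_1 fcarrier_nconst assms) auto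

lemma ngen_dj_fcarrier:
  assumes "i \<in> {1..N}"
  shows "ngen (Egen i) \<in> fcarrier (dj_gens N)" "ngen (Fgen i) \<in> fcarrier (dj_gens N)"
    "ngen (Kgen i) \<in> fcarrier (dj_gens N)" "ngen (Kinv i) \<in> fcarrier (dj_gens N)"
  using assms by (auto intro!: fcarrier_gen simp: dj_gens_def)

lemma ngen_torus_fcarrier:
  assumes "i \<in> {1..N}"
  shows "ngen (Xgen i) \<in> fcarrier (torus_gens N)" "ngen (Xinv i) \<in> fcarrier (torus_gens N)"
  using assms by (auto intro!: fcarrier_gen simp: torus_gens_def)

lemma dj_presentation: "presentation (dj_gens N) (dj_rels N C d)"
proof
  show "dj_rels N C d \<subseteq> fcarrier (dj_gens N)"
    unfolding dj_rels_def Let_def Un_subset_iff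
    by (intro conjI subsetI; elim CollectE exE conjE; hypsubst)
       (auto intro!: serre_element_fcarrier fcarrier_diff fcarrier_mult fcarrier_nconst fcarrier_1 fcarrier_0 ngen_dj_fcarrier)
qed

lemma torus_presentation: "presentation (torus_gens N) (torus_rels N Q)"
proof
  show "torus_rels N Q \<subseteq> fcarrier (torus_gens N)"
    unfolding torus_rels_def Let_def
    by (auto intro!: fcarrier_diff fcarrier_mult fcarrier_nconst fcarrier_1 ngen_torus_fcarrier)
qed

theorem corollary2p5:
  fixes N :: nat and C :: "nat \<Rightarrow> nat \<Rightarrow> int" and d :: "nat \<Rightarrow> nat"
    and Q :: "'e valued_quiver"
  assumes "generalized_cartan_matrix N C"
    and "is_symmetrizer N C d"
    and "valued_quiver_of N C d Q"
  shows "\<exists>\<phi> \<in> algebra_hom (iquantum_group N C d) (quantum_torus N Q).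
           \<forall>i\<in>{1..N}. \<phi> (iB N C d i) =
             torus_elem N Q (Xgen i) \<oplus>\<^bsub>quantum_torus N Q\<^esub> torus_elem N Q (Xinv i)"
proof -
  interpret cartan_quiver N C d Q by unfold_locales (fact assms)+
  interpret U: presentation "dj_gens N" "dj_rels N C d" by (rule dj_presentation)
  interpret V: presentation "torus_gens N" "torus_rels N Q" by (rule torus_presentation)
  have iB: "iB N C d i = U.cls (dj_B i)" if "i \<in> {1..N}" for i
    by (simp add: ngen_dj_fcarrier[OF that] iB_def Let_def quantum_group_def dj_elem_def presented_gen_eq dj_B_def U.cls_hom U.cls_scale fcarrier_mult fcarrier_scale)
  have B: "torus_elem N Q (Xgen i) \<oplus>\<^bsub>quantum_torus N Q\<^esub> torus_elem N Q (Xinv i) = V.cls (torus_B i)" if "i \<in> {1..N}" for i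
    by (simp add: ngen_torus_fcarrier[OF that] quantum_torus_def torus_elem_def presented_gen_eq torus_B_def V.cls_hom)
  have carriers: "dj_B i \<in> fcarrier (dj_gens N)" "torus_B i \<in> fcarrier (torus_gens N)" if "i \<in> {1..N}" for i
    unfolding dj_B_def torus_B_def using that
    by (auto intro!: fcarrier_add fcarrier_mult fcarrier_scale ngen_dj_fcarrier ngen_torus_fcarrier)
  have "iB N C d ` {1..N} = (\<lambda>i. U.cls (dj_B i)) ` {1..N}"
    using iB by (intro image_cong) auto
  then have "iquantum_group N C d = generated_subalgebra U.pres ((\<lambda>i. U.cls (dj_B i)) ` {1..N})"
    by (simp add: iquantum_group_def quantum_group_def)
  moreover have "\<exists>\<phi> \<in> algebra_hom (generated_subalgebra U.pres ((\<lambda>i. U.cls (dj_B i)) ` {1..N})) V.pres.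
     \<forall>i\<in>{1..N}. \<phi> (U.cls (dj_B i)) = V.cls (torus_B i)"
    by (rule subalgebra_hom_exists[OF dj_presentation torus_presentation carriers torus_relation])
  ultimately show ?thesis
    using iB B by (auto simp: quantum_torus_def)
qed

end
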